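(* Let $(\mathsf C,\otimes,K)$ be a braided monoidal small category, $X$ a set, and let $(\{(a(x,y),\delta_{x,y},\varepsilon_{x,y})\}_{(x,y)\in X^2},\{\mu_{x,y,z}\}_{(x,y,z)\in X^3},\{\eta_x\}_{x\in X})$ be a Hopf $\mathsf C$-category with object set $X$. The following assertions are equivalent. (i) The comonoid $\{(a(x,y),\delta_{x,y},\varepsilon_{x,y})\}_{(x,y)\in X^2}$ in the monoidal category $((\mathsf{span}\vert\mathsf C)(X,X),\bullet,j)$ is coseparable. (i') For every $(x,y)\in X^2$, the comonoid $(a(x,y),\delta_{x,y},\varepsilon_{x,y})$ in $(\mathsf C,\otimes,K)$ is coseparable. (ii) For all $x\in X$, $\eta_x:K\to a(x,x)$ has a left $a(x,x)$-comodule retraction; that is, for all $x\in X$ there is a morphism $\theta_x:a(x,x)\to K$ in $\mathsf C$ such that $(1\otimes\theta_x)\delta_{x,x}=\eta_x\theta_x$ and $\theta_x\eta_x=1_K$. (iii) For all $x\in X$, $\eta_x:K\to a(x,x)$ has a right $a(x,x)$-comodule retraction; that is, for all $x\in X$ there is a morphism $\theta_x:a(x,x)\to K$ in $\mathsf C$ such that $(\theta_x\otimes1)\delta_{x,x}=\eta_x\theta_x$ and $\theta_x\eta_x=1_K$.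
   Context: Associativity and unit isomorphisms of $\otimes$ are suppressed. Hopf $\mathsf C$-category. A category enriched in the monoidal category of comonoids in the braided monoidal category $\mathsf C$, with object set $X$, consists of comonoids $(a(x,y),\delta_{x,y},\varepsilon_{x,y})$ in $\mathsf C$ for $x,y\in X$, composition morphisms $\mu_{x,y,z}:a(x,y)\otimes a(y,z)\to a(x,z)$ and unit morphisms $\eta_x:K\to a(x,x)$, all of them comonoid morphisms, associative and unital. It is a Hopf $\mathsf C$-category if there are morphisms $\sigma_{x,y}:a(x,y)\to a(y,x)$ in $\mathsf C$ with $\mu_{x,y,x}(1\otimes\sigma_{x,y})\delta_{x,y}=\eta_x\varepsilon_{x,y}$ and $\mu_{y,x,y}(\sigma_{x,y}\otimes1)\delta_{x,y}=\eta_y\varepsilon_{x,y}$ for all $x,y\in X$. Coseparable comonoid. A comonoid in a monoidal category is coseparable if its comultiplication admits a retraction that is a morphism of bicomodules. The monoidal category $((\mathsf{span}\vert\mathsf C)(X,X),\bullet,j)$. An object is a span of sets $X\leftarrow A\to X$ with a map $a$ from $A$ to the set of objects of $\mathsf C$. A morphism $(A',a')\to(A,a)$ is a map of spans $f:A'\to A$ with a family of morphisms $\varphi_h:a'(h)\to a(f(h))$ in $\mathsf C$, $h\in A'$; composition is the evident one. The $\bullet$-product of $(A,a)$ and $(B,b)$ is the product $B\bullet A$ in the category of spans over $X,X$ (i.e. $B\times_{X\times X}A$) with the map $(d,h)\mapsto b(d)\otimes a(h)$; on morphisms it acts componentwise. The unit $j$ is the span $X\xleftarrow{p_1}X^2\xrightarrow{p_2}X$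 with the constant map at $K$. The comonoid in (i) has underlying span $X\xleftarrow{p_1}X^2\xrightarrow{p_2}X$, map $(x,y)\mapsto a(x,y)$, comultiplication given by the identity map $X^2\to X^2=X^2\bullet X^2$ and the morphisms $\delta_{x,y}$, and counit given by the identity map $X^2\to X^2$ and the morphisms $\varepsilon_{x,y}$. *)

theory Defs
  imports "HOL-Library.FuncSet"
begin

section \<open>Small monoidal and braided categories\<close>

text \<open>
  A small category is given by carrier sets of objects and of arrows; \<open>g \<cdot> f\<close> is the composite
  ``first \<open>f\<close>, then \<open>g\<close>''. The record operations are only meaningful on the carriers and on
  composable pairs.
\<close>

record ('o, 'm) cat =
  Obj :: "'o set"
  Arr :: "'m set"
  Src :: "'m \<Rightarrow> 'o"
  Tgt :: "'m \<Rightarrow> 'o"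
  Idn :: "'o \<Rightarrow> 'm" (\<open>\<one>\<index>\<close>)
  Cmp :: "'m \<Rightarrow> 'm \<Rightarrow> 'm" (infixl \<open>\<cdot>\<index>\<close> 65)

record ('o, 'm) moncat = "('o, 'm) cat" +
  Unt :: 'o (\<open>\<K>\<index>\<close>)
  TenO :: "'o \<Rightarrow> 'o \<Rightarrow> 'o" (infixl \<open>\<odot>\<index>\<close> 75)
  Ten :: "'m \<Rightarrow> 'm \<Rightarrow> 'm" (infixl \<open>\<otimes>\<index>\<close> 70)
  Asc :: "'o \<Rightarrow> 'o \<Rightarrow> 'o \<Rightarrow> 'm" (\<open>\<alpha>\<index>\<close>)
  Lun :: "'o \<Rightarrow> 'm" (\<open>\<lambda>\<lambda>\<index>\<close>)
  Run :: "'o \<Rightarrow> 'm" (\<open>\<rho>\<index>\<close>)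

record ('o, 'm) brcat = "('o, 'm) moncat" +
  Brd :: "'o \<Rightarrow> 'o \<Rightarrow> 'm" (\<open>\<c>\<index>\<close>)

definition hom :: "('o, 'm, 'z) cat_scheme \<Rightarrow> 'o \<Rightarrow> 'o \<Rightarrow> 'm set"
  where "hom C a b = {f \<in> Arr C. Src C f = a \<and> Tgt C f = b}"

definition inverse_arrows :: "('o, 'm, 'z) cat_scheme \<Rightarrow> 'm \<Rightarrow> 'm \<Rightarrow> bool"
  where "inverse_arrows C f g \<longleftrightarrow>
    f \<in> Arr C \<and> g \<in> hom C (Tgt C f) (Src C f) \<and>
    g \<cdot>\<^bsub>C\<^esub> f = \<one>\<^bsub>C\<^esub> (Src C f) \<and> f \<cdot>\<^bsub>C\<^esub> g = \<one>\<^bsub>C\<^esub> (Tgt C f)"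

definition iso :: "('o, 'm, 'z) cat_scheme \<Rightarrow> 'm \<Rightarrow> bool"
  where "iso C f \<longleftrightarrow> (\<exists>g. inverse_arrows C f g)"

definition inv_arr :: "('o, 'm, 'z) cat_scheme \<Rightarrow> 'm \<Rightarrow> 'm"
  where "inv_arr C f = (THE g. inverse_arrows C f g)"

locale category =
  fixes C :: "('o, 'm, 'z) cat_scheme" (structure)
  assumes src_obj: "f \<in> Arr C \<Longrightarrow> Src C f \<in> Obj C"
    and tgt_obj: "f \<in> Arr C \<Longrightarrow> Tgt C f \<in> Obj C"
    and idn_hom: "a \<in> Obj C \<Longrightarrow> \<one> a \<in> hom C a a"
    and cmp_hom: "\<lbrakk>f \<in> hom C a b; g \<in> hom C b c\<rbrakk> \<Longrightarrow> g \<cdot> f \<in> hom C a c"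
    and idn_left: "f \<in> hom C a b \<Longrightarrow> \<one> b \<cdot> f = f"
    and idn_right: "f \<in> hom C a b \<Longrightarrow> f \<cdot> \<one> a = f"
    and cmp_assoc: "\<lbrakk>f \<in> hom C a b; g \<in> hom C b c; h \<in> hom C c d\<rbrakk> \<Longrightarrow> (h \<cdot> g) \<cdot> f = h \<cdot> (g \<cdot> f)"

locale monoidal_category = category C
  for C :: "('o, 'm, 'z) moncat_scheme" (structure) +
  assumes unt_obj: "\<K> \<in> Obj C"
    and ten_obj: "\<lbrakk>a \<in> Obj C; b \<in> Obj C\<rbrakk> \<Longrightarrow> a \<odot> b \<in> Obj C"
    and ten_hom: "\<lbrakk>f \<in> hom C a b; g \<in> hom C a' b'\<rbrakk> \<Longrightarrow> f \<otimes> g \<in> hom C (a \<odot> a') (b \<odot> b')"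
    and ten_idn: "\<lbrakk>a \<in> Obj C; b \<in> Obj C\<rbrakk> \<Longrightarrow> \<one> a \<otimes> \<one> b = \<one> (a \<odot> b)"
    and ten_cmp: "\<lbrakk>f \<in> hom C a b; g \<in> hom C b c; f' \<in> hom C a' b'; g' \<in> hom C b' c'\<rbrakk>
      \<Longrightarrow> (g \<cdot> f) \<otimes> (g' \<cdot> f') = (g \<otimes> g') \<cdot> (f \<otimes> f')"
    and asc_hom: "\<lbrakk>a \<in> Obj C; b \<in> Obj C; c \<in> Obj C\<rbrakk> \<Longrightarrow> \<alpha> a b c \<in> hom C (a \<odot> b \<odot> c) (a \<odot> (b \<odot> c))"
    and asc_iso: "\<lbrakk>a \<in> Obj C; b \<in> Obj C; c \<in> Obj C\<rbrakk> \<Longrightarrow> iso C (\<alpha> a b c)"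
    and asc_nat: "\<lbrakk>f \<in> hom C a a'; g \<in> hom C b b'; h \<in> hom C c c'\<rbrakk>
      \<Longrightarrow> \<alpha> a' b' c' \<cdot> (f \<otimes> g \<otimes> h) = (f \<otimes> (g \<otimes> h)) \<cdot> \<alpha> a b c"
    and lun_hom: "a \<in> Obj C \<Longrightarrow> \<lambda>\<lambda> a \<in> hom C (\<K> \<odot> a) a"
    and lun_iso: "a \<in> Obj C \<Longrightarrow> iso C (\<lambda>\<lambda> a)"
    and lun_nat: "f \<in> hom C a b \<Longrightarrow> \<lambda>\<lambda> b \<cdot> (\<one> \<K> \<otimes> f) = f \<cdot> \<lambda>\<lambda> a"
    and run_hom: "a \<in> Obj C \<Longrightarrow> \<rho> a \<in> hom C (a \<odot> \<K>) a"
    and run_iso: "a \<in> Obj C \<Longrightarrow> iso C (\<rho> a)"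
    and run_nat: "f \<in> hom C a b \<Longrightarrow> \<rho> b \<cdot> (f \<otimes> \<one> \<K>) = f \<cdot> \<rho> a"
    and pentagon: "\<lbrakk>a \<in> Obj C; b \<in> Obj C; c \<in> Obj C; d \<in> Obj C\<rbrakk>
      \<Longrightarrow> (\<one> a \<otimes> \<alpha> b c d) \<cdot> \<alpha> a (b \<odot> c) d \<cdot> (\<alpha> a b c \<otimes> \<one> d)
        = \<alpha> a b (c \<odot> d) \<cdot> \<alpha> (a \<odot> b) c d"
    and triangle: "\<lbrakk>a \<in> Obj C; b \<in> Obj C\<rbrakk> \<Longrightarrow> (\<one> a \<otimes> \<lambda>\<lambda> b) \<cdot> \<alpha> a \<K> b = \<rho> a \<otimes> \<one> b"

locale braided_monoidal_category = monoidal_category C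
  for C :: "('o, 'm, 'z) brcat_scheme" (structure) +
  assumes brd_hom: "\<lbrakk>a \<in> Obj C; b \<in> Obj C\<rbrakk> \<Longrightarrow> \<c> a b \<in> hom C (a \<odot> b) (b \<odot> a)"
    and brd_iso: "\<lbrakk>a \<in> Obj C; b \<in> Obj C\<rbrakk> \<Longrightarrow> iso C (\<c> a b)"
    and brd_nat: "\<lbrakk>f \<in> hom C a a'; g \<in> hom C b b'\<rbrakk> \<Longrightarrow> \<c> a' b' \<cdot> (f \<otimes> g) = (g \<otimes> f) \<cdot> \<c> a b"
    and hexagon1: "\<lbrakk>a \<in> Obj C; b \<in> Obj C; c \<in> Obj C\<rbrakk>
      \<Longrightarrow> \<alpha> b c a \<cdot> \<c> a (b \<odot> c) \<cdot> \<alpha> a b c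
        = (\<one> b \<otimes> \<c> a c) \<cdot> \<alpha> b a c \<cdot> (\<c> a b \<otimes> \<one> c)"
    and hexagon2: "\<lbrakk>a \<in> Obj C; b \<in> Obj C; c \<in> Obj C\<rbrakk>
      \<Longrightarrow> inv_arr C (\<alpha> c a b) \<cdot> \<c> (a \<odot> b) c \<cdot> inv_arr C (\<alpha> a b c)
        = (\<c> a c \<otimes> \<one> b) \<cdot> inv_arr C (\<alpha> a c b) \<cdot> (\<one> a \<otimes> \<c> b c)"


section \<open>Comonoids, bicomodule morphisms and coseparability\<close>

definition comonoid :: "('o, 'm, 'z) moncat_scheme \<Rightarrow> 'o \<Rightarrow> 'm \<Rightarrow> 'm \<Rightarrow> bool"
  where "comonoid C A d e \<longleftrightarrow>
    A \<in> Obj C \<and> d \<in> hom C A (A \<odot>\<^bsub>C\<^esub> A) \<and> e \<in> hom C A \<K>\<^bsub>C\<^esub> \<and>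
    \<alpha>\<^bsub>C\<^esub> A A A \<cdot>\<^bsub>C\<^esub> (d \<otimes>\<^bsub>C\<^esub> \<one>\<^bsub>C\<^esub> A) \<cdot>\<^bsub>C\<^esub> d = (\<one>\<^bsub>C\<^esub> A \<otimes>\<^bsub>C\<^esub> d) \<cdot>\<^bsub>C\<^esub> d \<and>
    \<lambda>\<lambda>\<^bsub>C\<^esub> A \<cdot>\<^bsub>C\<^esub> (e \<otimes>\<^bsub>C\<^esub> \<one>\<^bsub>C\<^esub> A) \<cdot>\<^bsub>C\<^esub> d = \<one>\<^bsub>C\<^esub> A \<and>
    \<rho>\<^bsub>C\<^esub> A \<cdot>\<^bsub>C\<^esub> (\<one>\<^bsub>C\<^esub> A \<otimes>\<^bsub>C\<^esub> e) \<cdot>\<^bsub>C\<^esub> d = \<one>\<^bsub>C\<^esub> A"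

definition comonoid_hom ::
    "('o, 'm, 'z) moncat_scheme \<Rightarrow> 'o \<Rightarrow> 'm \<Rightarrow> 'm \<Rightarrow> 'o \<Rightarrow> 'm \<Rightarrow> 'm \<Rightarrow> 'm \<Rightarrow> bool"
  where "comonoid_hom C A d e A' d' e' f \<longleftrightarrow>
    f \<in> hom C A A' \<and> d' \<cdot>\<^bsub>C\<^esub> f = (f \<otimes>\<^bsub>C\<^esub> f) \<cdot>\<^bsub>C\<^esub> d \<and> e' \<cdot>\<^bsub>C\<^esub> f = e"

text \<open>
  Morphisms \<open>f : P \<rightarrow> Q\<close> of bicomodules over a comonoid on \<open>A\<close>, where \<open>P\<close> has left and right
  coactions \<open>l : P \<rightarrow> A \<odot> P\<close> and \<open>r : P \<rightarrow> P \<odot> A\<close>, and \<open>Q\<close> has coactions \<open>l'\<close> and \<open>r'\<close>.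
\<close>

definition bicomodule_hom ::
    "('o, 'm, 'z) moncat_scheme \<Rightarrow> 'o \<Rightarrow> 'o \<Rightarrow> 'm \<Rightarrow> 'm \<Rightarrow> 'o \<Rightarrow> 'm \<Rightarrow> 'm \<Rightarrow> 'm \<Rightarrow> bool"
  where "bicomodule_hom C A P l r Q l' r' f \<longleftrightarrow>
    f \<in> hom C P Q \<and>
    l' \<cdot>\<^bsub>C\<^esub> f = (\<one>\<^bsub>C\<^esub> A \<otimes>\<^bsub>C\<^esub> f) \<cdot>\<^bsub>C\<^esub> l \<and>
    r' \<cdot>\<^bsub>C\<^esub> f = (f \<otimes>\<^bsub>C\<^esub> \<one>\<^bsub>C\<^esub> A) \<cdot>\<^bsub>C\<^esub> r"

text \<open>
  \<open>A\<close> carries the regular bicomodule structure and \<open>A \<odot> A\<close> the one with coactions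
  \<open>d \<otimes> 1\<close> and \<open>1 \<otimes> d\<close>, corrected by the associator.
\<close>

definition coseparable :: "('o, 'm, 'z) moncat_scheme \<Rightarrow> 'o \<Rightarrow> 'm \<Rightarrow> 'm \<Rightarrow> bool"
  where "coseparable C A d e \<longleftrightarrow>
    comonoid C A d e \<and>
    (\<exists>p. bicomodule_hom C A
           (A \<odot>\<^bsub>C\<^esub> A) (\<alpha>\<^bsub>C\<^esub> A A A \<cdot>\<^bsub>C\<^esub> (d \<otimes>\<^bsub>C\<^esub> \<one>\<^bsub>C\<^esub> A)) (inv_arr C (\<alpha>\<^bsub>C\<^esub> A A A) \<cdot>\<^bsub>C\<^esub> (\<one>\<^bsub>C\<^esub> A \<otimes>\<^bsub>C\<^esub> d))
           A d d p \<and>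
         p \<cdot>\<^bsub>C\<^esub> d = \<one>\<^bsub>C\<^esub> A)"


section \<open>Hopf categories\<close>

definition middle_exchange :: "('o, 'm, 'z) brcat_scheme \<Rightarrow> 'o \<Rightarrow> 'o \<Rightarrow> 'o \<Rightarrow> 'o \<Rightarrow> 'm"
  where "middle_exchange C a b c d =
    inv_arr C (\<alpha>\<^bsub>C\<^esub> a c (b \<odot>\<^bsub>C\<^esub> d)) \<cdot>\<^bsub>C\<^esub>
    (\<one>\<^bsub>C\<^esub> a \<otimes>\<^bsub>C\<^esub> (\<alpha>\<^bsub>C\<^esub> c b d \<cdot>\<^bsub>C\<^esub> (\<c>\<^bsub>C\<^esub> b c \<otimes>\<^bsub>C\<^esub> \<one>\<^bsub>C\<^esub> d) \<cdot>\<^bsub>C\<^esub> inv_arr C (\<alpha>\<^bsub>C\<^esub> b c d))) \<cdot>\<^bsub>C\<^esub>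
    \<alpha>\<^bsub>C\<^esub> a b (c \<odot>\<^bsub>C\<^esub> d)"

text \<open>
  The tensor product of two comonoids uses the braiding \<open>A \<odot> A' \<rightarrow> A' \<odot> A\<close> (not its inverse) in the
  middle; the unit comonoid is \<open>\<K>\<close> with the canonical isomorphism \<open>\<K> \<rightarrow> \<K> \<odot> \<K>\<close>.
\<close>

definition tensor_comult :: "('o, 'm, 'z) brcat_scheme \<Rightarrow> 'o \<Rightarrow> 'm \<Rightarrow> 'o \<Rightarrow> 'm \<Rightarrow> 'm"
  where "tensor_comult C A d A' d' = middle_exchange C A A A' A' \<cdot>\<^bsub>C\<^esub> (d \<otimes>\<^bsub>C\<^esub> d')"

definition tensor_counit :: "('o, 'm, 'z) moncat_scheme \<Rightarrow> 'm \<Rightarrow> 'm \<Rightarrow> 'm"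
  where "tensor_counit C e e' = \<lambda>\<lambda>\<^bsub>C\<^esub> \<K>\<^bsub>C\<^esub> \<cdot>\<^bsub>C\<^esub> (e \<otimes>\<^bsub>C\<^esub> e')"

definition unit_comult :: "('o, 'm, 'z) moncat_scheme \<Rightarrow> 'm"
  where "unit_comult C = inv_arr C (\<lambda>\<lambda>\<^bsub>C\<^esub> \<K>\<^bsub>C\<^esub>)"

definition unit_counit :: "('o, 'm, 'z) moncat_scheme \<Rightarrow> 'm"
  where "unit_counit C = \<one>\<^bsub>C\<^esub> \<K>\<^bsub>C\<^esub>"

locale comonoid_enriched_category = braided_monoidal_category C
  for C :: "('o, 'm, 'z) brcat_scheme" (structure) +
  fixes X :: "'x set"
    and a :: "'x \<Rightarrow> 'x \<Rightarrow> 'o"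
    and \<delta> \<epsilon> :: "'x \<Rightarrow> 'x \<Rightarrow> 'm"
    and \<mu> :: "'x \<Rightarrow> 'x \<Rightarrow> 'x \<Rightarrow> 'm"
    and \<eta> :: "'x \<Rightarrow> 'm"
  assumes hom_comonoid: "\<lbrakk>x \<in> X; y \<in> X\<rbrakk> \<Longrightarrow> comonoid C (a x y) (\<delta> x y) (\<epsilon> x y)"
    and mult_comonoid_hom: "\<lbrakk>x \<in> X; y \<in> X; z \<in> X\<rbrakk> \<Longrightarrow>
      comonoid_hom C
        (a x y \<odot> a y z) (tensor_comult C (a x y) (\<delta> x y) (a y z) (\<delta> y z)) (tensor_counit C (\<epsilon> x y) (\<epsilon> y z))
        (a x z) (\<delta> x z) (\<epsilon> x z) (\<mu> x y z)"
    and unit_comonoid_hom: "x \<in> X \<Longrightarrow>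
      comonoid_hom C \<K> (unit_comult C) (unit_counit C) (a x x) (\<delta> x x) (\<epsilon> x x) (\<eta> x)"
    and mult_assoc: "\<lbrakk>x \<in> X; y \<in> X; z \<in> X; w \<in> X\<rbrakk> \<Longrightarrow>
      \<mu> x z w \<cdot> (\<mu> x y z \<otimes> \<one> (a z w))
      = \<mu> x y w \<cdot> (\<one> (a x y) \<otimes> \<mu> y z w) \<cdot> \<alpha> (a x y) (a y z) (a z w)"
    and mult_unit_left: "\<lbrakk>x \<in> X; y \<in> X\<rbrakk> \<Longrightarrow> \<mu> x x y \<cdot> (\<eta> x \<otimes> \<one> (a x y)) = \<lambda>\<lambda> (a x y)"
    and mult_unit_right: "\<lbrakk>x \<in> X; y \<in> X\<rbrakk> \<Longrightarrow> \<mu> x y y \<cdot> (\<one> (a x y) \<otimes> \<eta> y) = \<rho> (a x y)"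

locale hopf_category = comonoid_enriched_category +
  assumes antipode: "\<exists>\<sigma>. \<forall>x\<in>X. \<forall>y\<in>X.
    \<sigma> x y \<in> hom C (a x y) (a y x) \<and>
    \<mu> x y x \<cdot> (\<one> (a x y) \<otimes> \<sigma> x y) \<cdot> \<delta> x y = \<eta> x \<cdot> \<epsilon> x y \<and>
    \<mu> y x y \<cdot> (\<sigma> x y \<otimes> \<one> (a x y)) \<cdot> \<delta> x y = \<eta> y \<cdot> \<epsilon> x y"


section \<open>Spans over a monoidal category\<close>

text \<open>
  The apex of a span is a set of elements of the following type, which contains \<open>X\<^sup>2\<close> (via
  \<open>Base\<close>) and arbitrarily many further atoms (the type \<open>'s\<close> is an arbitrary universe), and which
  is closed under pairing (via \<open>Node\<close>), so that it contains the products \<open>B \<times>\<^bsub>X\<times>X\<^esub> A\<close>.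
\<close>

datatype ('x, 's) elt =
    Base (bleft: 'x) (bright: 'x)
  | Atom 's
  | Node (nleft: "('x, 's) elt") (nright: "('x, 's) elt")

record ('x, 's, 'o) span =
  Apex :: "('x, 's) elt set"
  LeftLeg :: "('x, 's) elt \<Rightarrow> 'x"
  RightLeg :: "('x, 's) elt \<Rightarrow> 'x"
  Label :: "('x, 's) elt \<Rightarrow> 'o"

record ('x, 's, 'o, 'm) span_arrow =
  SSrc :: "('x, 's, 'o) span"
  STgt :: "('x, 's, 'o) span"
  SMap :: "('x, 's) elt \<Rightarrow> ('x, 's) elt"
  SFam :: "('x, 's) elt \<Rightarrow> 'm"

text \<open>
  All functions on an apex are extensional, so that equality of spans and of their arrows is the
  mathematical one.
\<close>

definition make_span ::
    "('x, 's) elt set \<Rightarrow> (('x, 's) elt \<Rightarrow> 'x) \<Rightarrow> (('x, 's) elt \<Rightarrow> 'x) \<Rightarrow> (('x, 's) elt \<Rightarrow> 'o)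
      \<Rightarrow> ('x, 's, 'o) span"
  where "make_span A l r a =
    \<lparr>Apex = A, LeftLeg = restrict l A, RightLeg = restrict r A, Label = restrict a A\<rparr>"

definition make_arrow ::
    "('x, 's, 'o) span \<Rightarrow> ('x, 's, 'o) span \<Rightarrow> (('x, 's) elt \<Rightarrow> ('x, 's) elt) \<Rightarrow> (('x, 's) elt \<Rightarrow> 'm)
      \<Rightarrow> ('x, 's, 'o, 'm) span_arrow"
  where "make_arrow A B f \<phi> =
    \<lparr>SSrc = A, STgt = B, SMap = restrict f (Apex A), SFam = restrict \<phi> (Apex A)\<rparr>"

definition span_objects :: "('o, 'm, 'z) cat_scheme \<Rightarrow> 'x set \<Rightarrow> ('x, 's, 'o) span set"
  where "span_objects C X = {A.
    LeftLeg A \<in> Apex A \<rightarrow>\<^sub>E X \<and> RightLeg A \<in> Apex A \<rightarrow>\<^sub>E X \<and> Label A \<in> Apex A \<rightarrow>\<^sub>E Obj C}"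

definition span_arrows :: "('o, 'm, 'z) cat_scheme \<Rightarrow> 'x set \<Rightarrow> ('x, 's, 'o, 'm) span_arrow set"
  where "span_arrows C X = {F.
    SSrc F \<in> span_objects C X \<and> STgt F \<in> span_objects C X \<and>
    SMap F \<in> Apex (SSrc F) \<rightarrow>\<^sub>E Apex (STgt F) \<and>
    (\<forall>h\<in>Apex (SSrc F).
       LeftLeg (STgt F) (SMap F h) = LeftLeg (SSrc F) h \<and>
       RightLeg (STgt F) (SMap F h) = RightLeg (SSrc F) h) \<and>
    SFam F \<in> (\<Pi>\<^sub>E h\<in>Apex (SSrc F). hom C (Label (SSrc F) h) (Label (STgt F) (SMap F h)))}"

definition square_span :: "'x set \<Rightarrow> ('x \<Rightarrow> 'x \<Rightarrow> 'o) \<Rightarrow> ('x, 's, 'o) span"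
  where "square_span X a = make_span {Base x y |x y. x \<in> X \<and> y \<in> X}
    bleft bright (\<lambda>p. a (bleft p) (bright p))"

definition span_prod ::
    "('o, 'm, 'z) moncat_scheme \<Rightarrow> ('x, 's, 'o) span \<Rightarrow> ('x, 's, 'o) span \<Rightarrow> ('x, 's, 'o) span"
  where "span_prod C B A = make_span
    {Node d h |d h. d \<in> Apex B \<and> h \<in> Apex A \<and> LeftLeg B d = LeftLeg A h \<and> RightLeg B d = RightLeg A h}
    (\<lambda>p. LeftLeg B (nleft p)) (\<lambda>p. RightLeg B (nleft p))
    (\<lambda>p. Label B (nleft p) \<odot>\<^bsub>C\<^esub> Label A (nright p))"

definition span_category ::
    "('o, 'm, 'z) moncat_scheme \<Rightarrow> 'x set \<Rightarrow> (('x, 's, 'o) span, ('x, 's, 'o, 'm) span_arrow) moncat"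
  where "span_category C X = \<lparr>
    Obj = span_objects C X,
    Arr = span_arrows C X,
    Src = SSrc,
    Tgt = STgt,
    Idn = (\<lambda>A. make_arrow A A (\<lambda>h. h) (\<lambda>h. \<one>\<^bsub>C\<^esub> (Label A h))),
    Cmp = (\<lambda>G F. make_arrow (SSrc F) (STgt G)
             (\<lambda>h. SMap G (SMap F h)) (\<lambda>h. SFam G (SMap F h) \<cdot>\<^bsub>C\<^esub> SFam F h)),
    Unt = square_span X (\<lambda>x y. \<K>\<^bsub>C\<^esub>),
    TenO = span_prod C,
    Ten = (\<lambda>G F. make_arrow (span_prod C (SSrc G) (SSrc F)) (span_prod C (STgt G) (STgt F))
             (\<lambda>p. Node (SMap G (nleft p)) (SMap F (nright p)))
             (\<lambda>p. SFam G (nleft p) \<otimes>\<^bsub>C\<^esub> SFam F (nright p))),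
    Asc = (\<lambda>D B A. make_arrow (span_prod C (span_prod C D B) A) (span_prod C D (span_prod C B A))
             (\<lambda>p. Node (nleft (nleft p)) (Node (nright (nleft p)) (nright p)))
             (\<lambda>p. \<alpha>\<^bsub>C\<^esub> (Label D (nleft (nleft p))) (Label B (nright (nleft p))) (Label A (nright p)))),
    Lun = (\<lambda>A. make_arrow (span_prod C (square_span X (\<lambda>x y. \<K>\<^bsub>C\<^esub>)) A) A
             nright (\<lambda>p. \<lambda>\<lambda>\<^bsub>C\<^esub> (Label A (nright p)))),
    Run = (\<lambda>A. make_arrow (span_prod C A (square_span X (\<lambda>x y. \<K>\<^bsub>C\<^esub>))) A
             nleft (\<lambda>p. \<rho>\<^bsub>C\<^esub> (Label A (nleft p))))\<rparr>"

text \<open>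
  The product of \<open>A\<close> and \<open>B\<close> in \<open>span_prod C B A\<close> is the actual fibre product over \<open>X \<times> X\<close>, so
  \<open>X\<^sup>2 \<bullet> X\<^sup>2\<close> is not literally \<open>X\<^sup>2\<close>. The canonical bijection between \<open>X\<^sup>2\<close> and \<open>X\<^sup>2 \<bullet> X\<^sup>2\<close> is the diagonal \<open>p \<mapsto> Node p p\<close>; up to this
  identification the comultiplication has the identity as underlying map.
\<close>

definition span_comult ::
    "('o, 'm, 'z) moncat_scheme \<Rightarrow> 'x set \<Rightarrow> ('x \<Rightarrow> 'x \<Rightarrow> 'o) \<Rightarrow> ('x \<Rightarrow> 'x \<Rightarrow> 'm)
      \<Rightarrow> ('x, 's, 'o, 'm) span_arrow"
  where "span_comult C X a \<delta> =
    make_arrow (square_span X a) (span_prod C (square_span X a) (square_span X a))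
      (\<lambda>p. Node p p) (\<lambda>p. \<delta> (bleft p) (bright p))"

definition span_counit ::
    "('o, 'm, 'z) moncat_scheme \<Rightarrow> 'x set \<Rightarrow> ('x \<Rightarrow> 'x \<Rightarrow> 'o) \<Rightarrow> ('x \<Rightarrow> 'x \<Rightarrow> 'm)
      \<Rightarrow> ('x, 's, 'o, 'm) span_arrow"
  where "span_counit C X a \<epsilon> =
    make_arrow (square_span X a) (square_span X (\<lambda>x y. \<K>\<^bsub>C\<^esub>))
      (\<lambda>p. p) (\<lambda>p. \<epsilon> (bleft p) (bright p))"

end

theory Submission
  imports Defs
begin

text \<open>
  A bicomodule retraction of the comultiplication of a comonoid \<open>B\<close> amounts to a morphism
  \<open>\<tau> : B \<otimes> B \<rightarrow> K\<close> with \<open>\<tau> \<cdot> \<delta> = \<epsilon>\<close> and \<open>b\<^sub>1 \<tau>(b\<^sub>2 \<otimes> b') = \<tau>(b \<otimes> b'\<^sub>1) b'\<^sub>2\<close>; both sides of the last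
  identity are then the retraction. Restricting \<open>\<tau>\<close> along a group-like \<open>\<eta> : K \<rightarrow> B\<close> in the second
  argument yields a left comodule retraction of \<open>\<eta>\<close>. Conversely a left comodule retraction \<open>\<theta>\<close> of
  \<open>\<eta> x\<close> yields \<open>\<tau>(b \<otimes> b') = \<theta>(b \<sigma>(b'))\<close> on \<open>a x y\<close>. The right-handed statements are the left-handed
  ones in the category with the reversed tensor product, and coseparability in the category of spans
  over \<open>X\<^sup>2\<close> is coseparability over each point of \<open>X\<^sup>2\<close>.
\<close>

section \<open>Coherence in monoidal categories\<close>

text \<open>The form attached to a retraction \<open>p\<close> is
  \<open>\<epsilon> \<cdot> p\<close>. In the model case of a groupoid algebra, \<theta> reads off
  the coefficient of an identity, so \<theta>(b \<sigma>(b')) tests whether b and b' coincide; this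
  is the origin of the converse formula. Since b \<sigma>(b') lies in \<open>a x x\<close> for b and
  b' in \<open>a x y\<close>, retractions on the diagonal control all hom objects. The obstacle is
  the invariance of that form. Expanding the comultiplication of \<sigma>(b') would call for the
  antipode to reverse comultiplication, a braided computation of its own. Precomposing with the
  shear map of the action of \<open>a x x\<close> on \<open>a x y\<close> removes \<sigma> from both
  sides instead. Associators are explicit throughout; treating shear maps as coKleisli extensions
  settles the rebracketing of their composites once and for all. Reversing the tensor product also
  reverses the homs. It keeps the braiding, with its arguments exchanged, rather than passing to the
  inverse; this makes the tensor products of comonoids literally the same.\<close>

lemma hom_iff: "f \<in> hom C a b \<longleftrightarrow> f \<in> Arr C \<and> Src C f = a \<and> Tgt C f = b"
  by (simp add: hom_def)

section \<open>Inverses and cancellation in a category\<close>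

context category
begin

declare src_obj [simp] tgt_obj [simp]

lemma idn_simps [simp]:
  assumes "a \<in> Obj C"
  shows "\<one> a \<in> Arr C" "Src C (\<one> a) = a" "Tgt C (\<one> a) = a"
  using idn_hom[OF assms] by (simp_all add: hom_iff)

lemma cmp_simps [simp]:
  assumes "f \<in> Arr C" "g \<in> Arr C" "Src C g = Tgt C f"
  shows "g \<cdot> f \<in> Arr C" "Src C (g \<cdot> f) = Src C f" "Tgt C (g \<cdot> f) = Tgt C g"
  using cmp_hom[of f "Src C f" "Tgt C f" g "Tgt C g"] assms by (simp_all add: hom_iff)

lemma idn_left_simp [simp]: "\<lbrakk>f \<in> Arr C; Tgt C f = b\<rbrakk> \<Longrightarrow> \<one> b \<cdot> f = f"
  using idn_left[of f "Src C f" b] by (simp add: hom_iff)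

lemma idn_right_simp [simp]: "\<lbrakk>f \<in> Arr C; Src C f = a\<rbrakk> \<Longrightarrow> f \<cdot> \<one> a = f"
  using idn_right[of f a "Tgt C f"] by (simp add: hom_iff)

lemma cmp_assoc_simp [simp]:
  "\<lbrakk>f \<in> Arr C; g \<in> Arr C; h \<in> Arr C; Src C g = Tgt C f; Src C h = Tgt C g\<rbrakk>
    \<Longrightarrow> (h \<cdot> g) \<cdot> f = h \<cdot> (g \<cdot> f)"
  using cmp_assoc[of f "Src C f" "Tgt C f" g "Tgt C g" h "Tgt C h"] by (simp add: hom_iff)

text \<open>Composites are normalised to the right, so the left-hand side of an equation about
  \<open>g \<cdot> f\<close> typically occurs as \<open>g \<cdot> (f \<cdot> k)\<close>. This is the
  form in which such equations are applied below.\<close>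

lemma pre_cmp:
  assumes "g \<cdot> f = h" "f \<in> Arr C" "g \<in> Arr C" "Src C g = Tgt C f" "k \<in> Arr C" "Tgt C k = Src C f"
  shows "g \<cdot> (f \<cdot> k) = h \<cdot> k"
  using assms cmp_assoc_simp[of k f g] by simp

lemma inverse_arrows_unique:
  assumes "inverse_arrows C f g" "inverse_arrows C f h"
  shows "g = h"
proof -
  have *: "f \<in> Arr C" "g \<in> Arr C" "h \<in> Arr C" "Src C g = Tgt C f" "Tgt C g = Src C f"
    "Src C h = Tgt C f" "Tgt C h = Src C f" "g \<cdot> f = \<one> (Src C f)" "f \<cdot> h = \<one> (Tgt C f)"
    using assms by (auto simp: inverse_arrows_def hom_iff)
  then have "(g \<cdot> f) \<cdot> h = g \<cdot> (f \<cdot> h)"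
    by (intro cmp_assoc_simp) simp_all
  with * show ?thesis
    by (simp del: cmp_assoc_simp)
qed

lemma inv_arr_eq: "inverse_arrows C f g \<Longrightarrow> inv_arr C f = g"
  unfolding inv_arr_def using inverse_arrows_unique by blast

lemma iso_inverse_arrows: "iso C f \<Longrightarrow> inverse_arrows C f (inv_arr C f)"
  unfolding iso_def using inv_arr_eq by blast

lemma inverse_arrows_sym: "inverse_arrows C f g \<Longrightarrow> inverse_arrows C g f"
  by (auto simp: inverse_arrows_def hom_iff)

lemma inv_arr_simps [simp]:
  assumes "iso C f"
  shows "inv_arr C f \<in> Arr C" "Src C (inv_arr C f) = Tgt C f" "Tgt C (inv_arr C f) = Src C f"
    "inv_arr C f \<cdot> f = \<one> (Src C f)" "f \<cdot> inv_arr C f = \<one> (Tgt C f)"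
  using iso_inverse_arrows[OF assms] by (auto simp: inverse_arrows_def hom_iff)

lemma iso_arr: "iso C f \<Longrightarrow> f \<in> Arr C"
  by (auto simp: iso_def inverse_arrows_def)

lemma iso_inv_arr: "iso C f \<Longrightarrow> iso C (inv_arr C f)"
  using iso_inverse_arrows inverse_arrows_sym unfolding iso_def by blast

lemma inv_arr_inv_arr: "iso C f \<Longrightarrow> inv_arr C (inv_arr C f) = f"
  by (rule inv_arr_eq[OF inverse_arrows_sym[OF iso_inverse_arrows]])

lemma inv_arr_cancel [simp]:
  assumes "iso C f" "g \<in> Arr C"
  shows "Tgt C g = Src C f \<Longrightarrow> inv_arr C f \<cdot> (f \<cdot> g) = g"
    "Tgt C g = Tgt C f \<Longrightarrow> f \<cdot> (inv_arr C f \<cdot> g) = g"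
  using assms iso_arr[OF assms(1)]
  by (simp_all flip: cmp_assoc_simp)

lemma iso_cancel_right:
  assumes "iso C f" "g \<in> Arr C" "h \<in> Arr C" "Src C g = Tgt C f" "Src C h = Tgt C f"
    "g \<cdot> f = h \<cdot> f"
  shows "g = h"
proof -
  have f: "f \<in> Arr C"
    by (rule iso_arr) fact
  have "g = (g \<cdot> f) \<cdot> inv_arr C f"
    using assms(1-5) f by simp
  also have "\<dots> = (h \<cdot> f) \<cdot> inv_arr C f"
    by (simp only: assms(6))
  also have "\<dots> = h"
    using assms(1-5) f by simp
  finally show ?thesis .
qed

lemma iso_cancel_left:
  assumes "iso C f" "g \<in> Arr C" "h \<in> Arr C" "Tgt C g = Src C f" "Tgt C h = Src C f"
    "f \<cdot> g = f \<cdot> h"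
  shows "g = h"
  using assms inv_arr_cancel(1) by metis

lemma iso_cmp:
  assumes "iso C f" "iso C g" "Src C g = Tgt C f"
  shows "iso C (g \<cdot> f)"
  using assms iso_arr[OF assms(1)] iso_arr[OF assms(2)]
  unfolding iso_def[of _ "g \<cdot> f"] inverse_arrows_def
  by (intro exI[of _ "inv_arr C f \<cdot> inv_arr C g"]) (simp add: hom_iff)

end

section \<open>Normal forms for tensor products and Kelly's unit identities\<close>

context monoidal_category
begin

declare unt_obj [simp] ten_obj [simp] ten_idn [simp]

lemma ten_simps [simp]:
  assumes "f \<in> Arr C" "g \<in> Arr C"
  shows "f \<otimes> g \<in> Arr C" "Src C (f \<otimes> g) = Src C f \<odot> Src C g" "Tgt C (f \<otimes> g) = Tgt C f \<odot> Tgt C g"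
  using ten_hom[of f "Src C f" "Tgt C f" g "Src C g" "Tgt C g"] assms by (simp_all add: hom_iff)

text \<open>The second equation is the interchange law inside a right-nested composite. Merging can
  hide a factor that a naturality rule has to see, hence the later steps that remove
  \<open>ten_merge\<close>.\<close>

lemma ten_merge [simp]:
  assumes "f \<in> Arr C" "g \<in> Arr C" "f' \<in> Arr C" "g' \<in> Arr C" "Src C g = Tgt C f" "Src C g' = Tgt C f'"
  shows "(g \<otimes> g') \<cdot> (f \<otimes> f') = (g \<cdot> f) \<otimes> (g' \<cdot> f')"
    "\<lbrakk>k \<in> Arr C; Tgt C k = Src C f \<odot> Src C f'\<rbrakk>
      \<Longrightarrow> (g \<otimes> g') \<cdot> ((f \<otimes> f') \<cdot> k) = ((g \<cdot> f) \<otimes> (g' \<cdot> f')) \<cdot> k"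
proof -
  show *: "(g \<otimes> g') \<cdot> (f \<otimes> f') = (g \<cdot> f) \<otimes> (g' \<cdot> f')"
    using ten_cmp[of f "Src C f" "Tgt C f" g "Tgt C g" f' "Src C f'" "Tgt C f'" g' "Tgt C g'"] assms
    by (simp add: hom_iff)
  assume "k \<in> Arr C" "Tgt C k = Src C f \<odot> Src C f'"
  then show "(g \<otimes> g') \<cdot> ((f \<otimes> f') \<cdot> k) = ((g \<cdot> f) \<otimes> (g' \<cdot> f')) \<cdot> k"
    using assms * by (simp flip: cmp_assoc_simp)
qed

lemma iso_ten:
  assumes "iso C f" "iso C g"
  shows "iso C (f \<otimes> g)"
  using assms iso_arr[OF assms(1)] iso_arr[OF assms(2)]
  unfolding iso_def[of _ "f \<otimes> g"] inverse_arrows_def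
  by (intro exI[of _ "inv_arr C f \<otimes> inv_arr C g"]) (simp add: hom_iff)

lemma iso_idn [simp]: "a \<in> Obj C \<Longrightarrow> iso C (\<one> a)"
  unfolding iso_def inverse_arrows_def by (intro exI[of _ "\<one> a"]) (simp add: hom_iff)

lemma asc_simps [simp]:
  assumes "a \<in> Obj C" "b \<in> Obj C" "c \<in> Obj C"
  shows "iso C (\<alpha> a b c)" "\<alpha> a b c \<in> Arr C" "Src C (\<alpha> a b c) = a \<odot> b \<odot> c"
    "Tgt C (\<alpha> a b c) = a \<odot> (b \<odot> c)"
  using asc_iso[OF assms] asc_hom[OF assms] by (simp_all add: hom_iff)

lemma lun_simps [simp]:
  assumes "a \<in> Obj C"
  shows "iso C (\<lambda>\<lambda> a)" "\<lambda>\<lambda> a \<in> Arr C" "Src C (\<lambda>\<lambda> a) = \<K> \<odot> a" "Tgt C (\<lambda>\<lambda> a) = a"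
  using lun_iso[OF assms] lun_hom[OF assms] by (simp_all add: hom_iff)

lemma run_simps [simp]:
  assumes "a \<in> Obj C"
  shows "iso C (\<rho> a)" "\<rho> a \<in> Arr C" "Src C (\<rho> a) = a \<odot> \<K>" "Tgt C (\<rho> a) = a"
  using run_iso[OF assms] run_hom[OF assms] by (simp_all add: hom_iff)

lemma asc_nat_src:
  "\<lbrakk>f \<in> Arr C; g \<in> Arr C; h \<in> Arr C\<rbrakk> \<Longrightarrow>
    \<alpha> (Tgt C f) (Tgt C g) (Tgt C h) \<cdot> (f \<otimes> g \<otimes> h)
      = (f \<otimes> (g \<otimes> h)) \<cdot> \<alpha> (Src C f) (Src C g) (Src C h)"
  by (rule asc_nat) (simp_all add: hom_iff)

lemma lun_nat_src: "f \<in> Arr C \<Longrightarrow> \<lambda>\<lambda> (Tgt C f) \<cdot> (\<one> \<K> \<otimes> f) = f \<cdot> \<lambda>\<lambda> (Src C f)"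
  by (rule lun_nat) (simp add: hom_iff)

lemma run_nat_src: "f \<in> Arr C \<Longrightarrow> \<rho> (Tgt C f) \<cdot> (f \<otimes> \<one> \<K>) = f \<cdot> \<rho> (Src C f)"
  by (rule run_nat) (simp add: hom_iff)

lemma asc_inv_nat_src:
  assumes "f \<in> Arr C" "g \<in> Arr C" "h \<in> Arr C"
  shows "inv_arr C (\<alpha> (Tgt C f) (Tgt C g) (Tgt C h)) \<cdot> (f \<otimes> (g \<otimes> h))
      = (f \<otimes> g \<otimes> h) \<cdot> inv_arr C (\<alpha> (Src C f) (Src C g) (Src C h))"
proof (rule iso_cancel_left)
  show "\<alpha> (Tgt C f) (Tgt C g) (Tgt C h) \<cdot> (inv_arr C (\<alpha> (Tgt C f) (Tgt C g) (Tgt C h)) \<cdot> (f \<otimes> (g \<otimes> h)))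
    = \<alpha> (Tgt C f) (Tgt C g) (Tgt C h) \<cdot> ((f \<otimes> g \<otimes> h) \<cdot> inv_arr C (\<alpha> (Src C f) (Src C g) (Src C h)))"
    using assms asc_nat_src[OF assms]
    by (simp flip: cmp_assoc_simp) simp
qed (use assms in simp_all)

text \<open>Naturality of \<open>\<lambda>\<lambda>\<close> expresses f through
  \<open>\<one> \<K> \<otimes> f\<close> and invertible maps. Unit coherence can thus be checked
  after tensoring with \<open>\<K>\<close>, where the pentagon and the triangle apply.\<close>

lemma unt_ten_left_faithful:
  assumes "f \<in> Arr C" "g \<in> Arr C" "Src C f = Src C g" "Tgt C f = Tgt C g" "\<one> \<K> \<otimes> f = \<one> \<K> \<otimes> g"
  shows "f = g"
  using lun_nat_src[of f] lun_nat_src[of g] assms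
  by (auto intro: iso_cancel_right[of "\<lambda>\<lambda> (Src C f)"])

lemma unt_ten_right_faithful:
  assumes "f \<in> Arr C" "g \<in> Arr C" "Src C f = Src C g" "Tgt C f = Tgt C g" "f \<otimes> \<one> \<K> = g \<otimes> \<one> \<K>"
  shows "f = g"
  using run_nat_src[of f] run_nat_src[of g] assms
  by (auto intro: iso_cancel_right[of "\<rho> (Src C f)"])

lemma pentagon':
  assumes "a \<in> Obj C" "b \<in> Obj C" "c \<in> Obj C" "d \<in> Obj C"
  shows "(\<one> a \<otimes> \<alpha> b c d) \<cdot> (\<alpha> a (b \<odot> c) d \<cdot> (\<alpha> a b c \<otimes> \<one> d))
        = \<alpha> a b (c \<odot> d) \<cdot> \<alpha> (a \<odot> b) c d"
  using pentagon[OF assms] assms by simp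

text \<open>Kelly's argument: the pentagon for \<open>\<K>\<close>, \<open>\<K>\<close>, a, b links
  two instances of the triangle. This proves the identity tensored with \<open>\<K>\<close> and
  followed by invertible associators, which cancel.\<close>

lemma lun_asc:
  assumes [simp]: "a \<in> Obj C" "b \<in> Obj C"
  shows "\<lambda>\<lambda> (a \<odot> b) \<cdot> \<alpha> \<K> a b = \<lambda>\<lambda> a \<otimes> \<one> b"
proof (rule unt_ten_left_faithful)
  let ?i = "\<alpha> \<K> (\<K> \<odot> a) b \<cdot> (\<alpha> \<K> \<K> a \<otimes> \<one> b)"
  have "(\<one> \<K> \<otimes> (\<lambda>\<lambda> (a \<odot> b) \<cdot> \<alpha> \<K> a b)) \<cdot> ?i = (\<one> \<K> \<otimes> \<lambda>\<lambda> (a \<odot> b)) \<cdot> ((\<one> \<K> \<otimes> \<alpha> \<K> a b) \<cdot> ?i)"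
    by simp
  also have "\<dots> = (\<rho> \<K> \<otimes> \<one> (a \<odot> b)) \<cdot> \<alpha> (\<K> \<odot> \<K>) a b"
    unfolding pentagon'[OF unt_obj unt_obj assms] by (rule pre_cmp[OF triangle]) simp_all
  also have "\<dots> = \<alpha> \<K> a b \<cdot> ((\<rho> \<K> \<otimes> \<one> a) \<otimes> \<one> b)"
    using asc_nat_src[of "\<rho> \<K>" "\<one> a" "\<one> b"] by simp
  also have "\<dots> = \<alpha> \<K> a b \<cdot> (((\<one> \<K> \<otimes> \<lambda>\<lambda> a) \<otimes> \<one> b) \<cdot> (\<alpha> \<K> \<K> a \<otimes> \<one> b))"
    using triangle[of \<K> a] by simp
  also have "\<dots> = (\<one> \<K> \<otimes> (\<lambda>\<lambda> a \<otimes> \<one> b)) \<cdot> ?i"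
    using pre_cmp[OF asc_nat_src[of "\<one> \<K>" "\<lambda>\<lambda> a" "\<one> b"], of "\<alpha> \<K> \<K> a \<otimes> \<one> b"] by (simp del: ten_merge)
  finally show "\<one> \<K> \<otimes> (\<lambda>\<lambda> (a \<odot> b) \<cdot> \<alpha> \<K> a b) = \<one> \<K> \<otimes> (\<lambda>\<lambda> a \<otimes> \<one> b)"
    by (rule iso_cancel_right[rotated -1]) (simp_all add: iso_cmp iso_ten)
qed simp_all

text \<open>The mirror image of the preceding argument, on the pentagon for a, b,
  \<open>\<K>\<close>, \<open>\<K>\<close>.\<close>

lemma run_asc:
  assumes [simp]: "a \<in> Obj C" "b \<in> Obj C"
  shows "(\<one> a \<otimes> \<rho> b) \<cdot> \<alpha> a b \<K> = \<rho> (a \<odot> b)"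
proof (rule unt_ten_right_faithful)
  have "\<alpha> a b \<K> \<cdot> (((\<one> a \<otimes> \<rho> b) \<cdot> \<alpha> a b \<K>) \<otimes> \<one> \<K>)
      = \<alpha> a b \<K> \<cdot> (((\<one> a \<otimes> \<rho> b) \<otimes> \<one> \<K>) \<cdot> (\<alpha> a b \<K> \<otimes> \<one> \<K>))"
    by simp
  also have "\<dots> = (\<one> a \<otimes> (\<rho> b \<otimes> \<one> \<K>)) \<cdot> (\<alpha> a (b \<odot> \<K>) \<K> \<cdot> (\<alpha> a b \<K> \<otimes> \<one> \<K>))"
    using pre_cmp[OF asc_nat_src[of "\<one> a" "\<rho> b" "\<one> \<K>"], of "\<alpha> a b \<K> \<otimes> \<one> \<K>"] by (simp del: ten_merge)
  also have "\<dots> = (\<one> a \<otimes> (\<one> b \<otimes> \<lambda>\<lambda> \<K>)) \<cdot> ((\<one> a \<otimes> \<alpha> b \<K> \<K>) \<cdot> (\<alpha> a (b \<odot> \<K>) \<K> \<cdot> (\<alpha> a b \<K> \<otimes> \<one> \<K>)))"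
    using triangle[of b \<K>] by simp
  also have "\<dots> = \<alpha> a b \<K> \<cdot> ((\<one> (a \<odot> b) \<otimes> \<lambda>\<lambda> \<K>) \<cdot> \<alpha> (a \<odot> b) \<K> \<K>)"
    using pre_cmp[OF asc_nat_src[of "\<one> a" "\<one> b" "\<lambda>\<lambda> \<K>"], of "\<alpha> (a \<odot> b) \<K> \<K>"]
    by (simp del: ten_merge add: pentagon')
  also have "\<dots> = \<alpha> a b \<K> \<cdot> (\<rho> (a \<odot> b) \<otimes> \<one> \<K>)"
    using triangle[of "a \<odot> b" \<K>] by simp
  finally show "((\<one> a \<otimes> \<rho> b) \<cdot> \<alpha> a b \<K>) \<otimes> \<one> \<K> = \<rho> (a \<odot> b) \<otimes> \<one> \<K>"
    by (rule iso_cancel_left[rotated -1]) simp_all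
qed simp_all

text \<open>Naturality of \<open>\<lambda>\<lambda>\<close> at
  \<open>\<lambda>\<lambda> \<K>\<close> yields \<open>\<lambda>\<lambda> (\<K> \<odot> \<K>) =
  \<one> \<K> \<otimes> \<lambda>\<lambda> \<K>\<close>. Then \<open>lun_asc\<close> and the
  triangle describe the same map tensored with \<open>\<K>\<close>.\<close>

lemma lun_unt: "\<lambda>\<lambda> \<K> = \<rho> \<K>"
proof (rule unt_ten_right_faithful)
  have "\<lambda>\<lambda> \<K> \<cdot> \<lambda>\<lambda> (\<K> \<odot> \<K>) = \<lambda>\<lambda> \<K> \<cdot> (\<one> \<K> \<otimes> \<lambda>\<lambda> \<K>)"
    using lun_nat_src[of "\<lambda>\<lambda> \<K>"] by simp
  then have "\<lambda>\<lambda> (\<K> \<odot> \<K>) = \<one> \<K> \<otimes> \<lambda>\<lambda> \<K>"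
    by (rule iso_cancel_left[rotated -1]) simp_all
  then show "\<lambda>\<lambda> \<K> \<otimes> \<one> \<K> = \<rho> \<K> \<otimes> \<one> \<K>"
    using lun_asc[of \<K> \<K>] triangle[of \<K> \<K>] by simp
qed simp_all

lemma triangle_inv:
  assumes [simp]: "a \<in> Obj C" "b \<in> Obj C"
  shows "(\<rho> a \<otimes> \<one> b) \<cdot> inv_arr C (\<alpha> a \<K> b) = \<one> a \<otimes> \<lambda>\<lambda> b"
  unfolding triangle[OF assms, symmetric] by simp

lemma lun_asc_inv:
  assumes [simp]: "a \<in> Obj C" "b \<in> Obj C"
  shows "(\<lambda>\<lambda> a \<otimes> \<one> b) \<cdot> inv_arr C (\<alpha> \<K> a b) = \<lambda>\<lambda> (a \<odot> b)"
  unfolding lun_asc[OF assms, symmetric] by simp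

text \<open>The pentagon solved for the shape met when coassociativity is applied under a tensor
  factor, as in \<open>coext_coext\<close>. It also becomes the pentagon of the reversed tensor
  product.\<close>

lemma pentagon_inv:
  assumes [simp]: "a \<in> Obj C" "b \<in> Obj C" "c \<in> Obj C" "d \<in> Obj C"
  shows "inv_arr C (\<alpha> (a \<odot> b) c d) \<cdot> (inv_arr C (\<alpha> a b (c \<odot> d)) \<cdot> (\<one> a \<otimes> \<alpha> b c d))
      = (inv_arr C (\<alpha> a b c) \<otimes> \<one> d) \<cdot> inv_arr C (\<alpha> a (b \<odot> c) d)"
proof (rule iso_cancel_left[of "\<alpha> a b (c \<odot> d) \<cdot> \<alpha> (a \<odot> b) c d"])
  let ?r = "(inv_arr C (\<alpha> a b c) \<otimes> \<one> d) \<cdot> inv_arr C (\<alpha> a (b \<odot> c) d)"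
  have "(\<alpha> a b (c \<odot> d) \<cdot> \<alpha> (a \<odot> b) c d) \<cdot> ?r
      = ((\<one> a \<otimes> \<alpha> b c d) \<cdot> (\<alpha> a (b \<odot> c) d \<cdot> (\<alpha> a b c \<otimes> \<one> d))) \<cdot> ?r"
    by (simp only: pentagon' assms)
  also have "\<dots> = \<one> a \<otimes> \<alpha> b c d"
    by simp
  finally show "(\<alpha> a b (c \<odot> d) \<cdot> \<alpha> (a \<odot> b) c d) \<cdot> (inv_arr C (\<alpha> (a \<odot> b) c d) \<cdot> (inv_arr C (\<alpha> a b (c \<odot> d)) \<cdot> (\<one> a \<otimes> \<alpha> b c d)))
    = (\<alpha> a b (c \<odot> d) \<cdot> \<alpha> (a \<odot> b) c d) \<cdot> ?r"
    by simp
qed (simp_all add: iso_cmp)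

end

section \<open>The braiding with the unit object\<close>

context braided_monoidal_category
begin

lemma brd_simps [simp]:
  assumes "a \<in> Obj C" "b \<in> Obj C"
  shows "iso C (\<c> a b)" "\<c> a b \<in> Arr C" "Src C (\<c> a b) = a \<odot> b" "Tgt C (\<c> a b) = b \<odot> a"
  using brd_iso[OF assms] brd_hom[OF assms] by (simp_all add: hom_iff)

lemma brd_nat_src:
  "\<lbrakk>f \<in> Arr C; g \<in> Arr C\<rbrakk> \<Longrightarrow>
    \<c> (Tgt C f) (Tgt C g) \<cdot> (f \<otimes> g) = (g \<otimes> f) \<cdot> \<c> (Src C f) (Src C g)"
  by (rule brd_nat) (simp_all add: hom_iff)

text \<open>The second hexagon for \<open>\<K>\<close>, \<open>\<K>\<close>, b contains the braiding
  of \<open>\<K>\<close> and b twice. One occurrence is an invertible right factor and cancels; what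
  remains is the claim tensored with \<open>\<K>\<close>.\<close>

lemma run_brd:
  assumes [simp]: "b \<in> Obj C"
  shows "\<rho> b \<cdot> \<c> \<K> b = \<lambda>\<lambda> b"
proof (rule unt_ten_right_faithful)
  let ?ai = "inv_arr C (\<alpha> \<K> \<K> b)" and ?aj = "inv_arr C (\<alpha> \<K> b \<K>)"
  have "\<lambda>\<lambda> (b \<odot> \<K>) \<cdot> (\<one> \<K> \<otimes> \<c> \<K> b) = \<c> \<K> b \<cdot> \<lambda>\<lambda> (\<K> \<odot> b)"
    using lun_nat_src[of "\<c> \<K> b"] by simp
  also have "\<dots> = \<c> \<K> b \<cdot> ((\<lambda>\<lambda> \<K> \<otimes> \<one> b) \<cdot> ?ai)"
    by (simp add: lun_asc_inv)
  also have "\<dots> = (\<one> b \<otimes> \<lambda>\<lambda> \<K>) \<cdot> (\<c> (\<K> \<odot> \<K>) b \<cdot> ?ai)"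
    using pre_cmp[OF brd_nat_src[of "\<lambda>\<lambda> \<K>" "\<one> b"], of ?ai] by simp
  also have "\<dots> = (\<rho> b \<otimes> \<one> \<K>) \<cdot> (inv_arr C (\<alpha> b \<K> \<K>) \<cdot> (\<c> (\<K> \<odot> \<K>) b \<cdot> ?ai))"
    using pre_cmp[OF triangle_inv[of b \<K>], of "\<c> (\<K> \<odot> \<K>) b \<cdot> ?ai"] by simp
  also have "\<dots> = (\<rho> b \<otimes> \<one> \<K>) \<cdot> ((\<c> \<K> b \<otimes> \<one> \<K>) \<cdot> (?aj \<cdot> (\<one> \<K> \<otimes> \<c> \<K> b)))"
    using hexagon2[of \<K> \<K> b] by simp
  also have "\<dots> = (((\<rho> b \<cdot> \<c> \<K> b) \<otimes> \<one> \<K>) \<cdot> ?aj) \<cdot> (\<one> \<K> \<otimes> \<c> \<K> b)"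
    by simp
  finally have "\<lambda>\<lambda> (b \<odot> \<K>) = ((\<rho> b \<cdot> \<c> \<K> b) \<otimes> \<one> \<K>) \<cdot> ?aj"
    by (rule iso_cancel_right[rotated -1]) (simp_all add: iso_ten)
  then have "(\<lambda>\<lambda> b \<otimes> \<one> \<K>) \<cdot> ?aj = ((\<rho> b \<cdot> \<c> \<K> b) \<otimes> \<one> \<K>) \<cdot> ?aj"
    by (simp add: lun_asc_inv)
  then show "(\<rho> b \<cdot> \<c> \<K> b) \<otimes> \<one> \<K> = \<lambda>\<lambda> b \<otimes> \<one> \<K>"
    by (rule iso_cancel_right[rotated -1, symmetric]) (simp_all add: iso_inv_arr)
qed simp_all

end

context monoidal_category
begin

text \<open>
  In the following rewrite rules the structural isomorphisms move towards the source, while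
  \<open>ten_merge\<close> collects parallel factors.
\<close>

lemma asc_push:
  assumes "f \<in> Arr C" "g \<in> Arr C" "h \<in> Arr C" "Tgt C f = a" "Tgt C g = b" "Tgt C h = c"
  shows "\<alpha> a b c \<cdot> (f \<otimes> g \<otimes> h) = (f \<otimes> (g \<otimes> h)) \<cdot> \<alpha> (Src C f) (Src C g) (Src C h)"
    and "\<lbrakk>k \<in> Arr C; Tgt C k = Src C f \<odot> Src C g \<odot> Src C h\<rbrakk> \<Longrightarrow>
      \<alpha> a b c \<cdot> ((f \<otimes> g \<otimes> h) \<cdot> k) = (f \<otimes> (g \<otimes> h)) \<cdot> (\<alpha> (Src C f) (Src C g) (Src C h) \<cdot> k)"
proof -
  show *: "\<alpha> a b c \<cdot> (f \<otimes> g \<otimes> h) = (f \<otimes> (g \<otimes> h)) \<cdot> \<alpha> (Src C f) (Src C g) (Src C h)"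
    using asc_nat_src[of f g h] assms by simp
  show "\<lbrakk>k \<in> Arr C; Tgt C k = Src C f \<odot> Src C g \<odot> Src C h\<rbrakk> \<Longrightarrow>
      \<alpha> a b c \<cdot> ((f \<otimes> g \<otimes> h) \<cdot> k) = (f \<otimes> (g \<otimes> h)) \<cdot> (\<alpha> (Src C f) (Src C g) (Src C h) \<cdot> k)"
    using pre_cmp[OF *, of k] assms by auto
qed

lemma asc_inv_push:
  assumes "f \<in> Arr C" "g \<in> Arr C" "h \<in> Arr C" "Tgt C f = a" "Tgt C g = b" "Tgt C h = c"
  shows "inv_arr C (\<alpha> a b c) \<cdot> (f \<otimes> (g \<otimes> h))
      = (f \<otimes> g \<otimes> h) \<cdot> inv_arr C (\<alpha> (Src C f) (Src C g) (Src C h))"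
    and "\<lbrakk>k \<in> Arr C; Tgt C k = Src C f \<odot> (Src C g \<odot> Src C h)\<rbrakk> \<Longrightarrow>
      inv_arr C (\<alpha> a b c) \<cdot> ((f \<otimes> (g \<otimes> h)) \<cdot> k)
        = (f \<otimes> g \<otimes> h) \<cdot> (inv_arr C (\<alpha> (Src C f) (Src C g) (Src C h)) \<cdot> k)"
proof -
  show *: "inv_arr C (\<alpha> a b c) \<cdot> (f \<otimes> (g \<otimes> h))
      = (f \<otimes> g \<otimes> h) \<cdot> inv_arr C (\<alpha> (Src C f) (Src C g) (Src C h))"
    using asc_inv_nat_src[of f g h] assms by simp
  show "\<lbrakk>k \<in> Arr C; Tgt C k = Src C f \<odot> (Src C g \<odot> Src C h)\<rbrakk> \<Longrightarrow>
      inv_arr C (\<alpha> a b c) \<cdot> ((f \<otimes> (g \<otimes> h)) \<cdot> k)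
        = (f \<otimes> g \<otimes> h) \<cdot> (inv_arr C (\<alpha> (Src C f) (Src C g) (Src C h)) \<cdot> k)"
    using pre_cmp[OF *, of k] assms by auto
qed

text \<open>\<open>ten_idn\<close> fuses adjacent identities, after which \<open>asc_push\<close> no
  longer matches; these are its instances in fused form.\<close>

lemma asc_push_idn:
  assumes "a \<in> Obj C" "b \<in> Obj C" "h \<in> Arr C" "Tgt C h = c"
  shows "\<alpha> a b c \<cdot> (\<one> (a \<odot> b) \<otimes> h) = (\<one> a \<otimes> (\<one> b \<otimes> h)) \<cdot> \<alpha> a b (Src C h)"
    and "\<lbrakk>k \<in> Arr C; Tgt C k = a \<odot> b \<odot> Src C h\<rbrakk> \<Longrightarrow>
      \<alpha> a b c \<cdot> ((\<one> (a \<odot> b) \<otimes> h) \<cdot> k) = (\<one> a \<otimes> (\<one> b \<otimes> h)) \<cdot> (\<alpha> a b (Src C h) \<cdot> k)"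
  using asc_push(1)[of "\<one> a" "\<one> b" h a b c] asc_push(2)[of "\<one> a" "\<one> b" h a b c k] assms by auto

lemma asc_inv_push_idn:
  assumes "f \<in> Arr C" "b \<in> Obj C" "c \<in> Obj C" "Tgt C f = a"
  shows "inv_arr C (\<alpha> a b c) \<cdot> (f \<otimes> \<one> (b \<odot> c)) = ((f \<otimes> \<one> b) \<otimes> \<one> c) \<cdot> inv_arr C (\<alpha> (Src C f) b c)"
    and "\<lbrakk>k \<in> Arr C; Tgt C k = Src C f \<odot> (b \<odot> c)\<rbrakk> \<Longrightarrow>
      inv_arr C (\<alpha> a b c) \<cdot> ((f \<otimes> \<one> (b \<odot> c)) \<cdot> k)
        = ((f \<otimes> \<one> b) \<otimes> \<one> c) \<cdot> (inv_arr C (\<alpha> (Src C f) b c) \<cdot> k)"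
  using asc_inv_push(1)[of f "\<one> b" "\<one> c" a b c] asc_inv_push(2)[of f "\<one> b" "\<one> c" a b c k] assms by auto

text \<open>Here \<open>ten_merge\<close> has absorbed x into the first tensor factor. Naturality
  must split it off again before the associator can pass.\<close>

lemma asc_push_left:
  assumes "f \<in> Arr C" "g \<in> Arr C" "h \<in> Arr C" "x \<in> Arr C" "Tgt C x = Src C f \<odot> Src C g"
    "Tgt C f = a" "Tgt C g = b" "Tgt C h = c"
  shows "\<alpha> a b c \<cdot> (((f \<otimes> g) \<cdot> x) \<otimes> h)
      = (f \<otimes> (g \<otimes> h)) \<cdot> (\<alpha> (Src C f) (Src C g) (Src C h) \<cdot> (x \<otimes> \<one> (Src C h)))"
    and "\<lbrakk>k \<in> Arr C; Tgt C k = Src C x \<odot> Src C h\<rbrakk> \<Longrightarrow>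
      \<alpha> a b c \<cdot> ((((f \<otimes> g) \<cdot> x) \<otimes> h) \<cdot> k)
      = (f \<otimes> (g \<otimes> h)) \<cdot> (\<alpha> (Src C f) (Src C g) (Src C h) \<cdot> ((x \<otimes> \<one> (Src C h)) \<cdot> k))"
proof -
  show *: "\<alpha> a b c \<cdot> (((f \<otimes> g) \<cdot> x) \<otimes> h)
      = (f \<otimes> (g \<otimes> h)) \<cdot> (\<alpha> (Src C f) (Src C g) (Src C h) \<cdot> (x \<otimes> \<one> (Src C h)))"
    using asc_push(2)[of f g h a b c "x \<otimes> \<one> (Src C h)"] assms by simp
  show "\<lbrakk>k \<in> Arr C; Tgt C k = Src C x \<odot> Src C h\<rbrakk> \<Longrightarrow>
      \<alpha> a b c \<cdot> ((((f \<otimes> g) \<cdot> x) \<otimes> h) \<cdot> k)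
      = (f \<otimes> (g \<otimes> h)) \<cdot> (\<alpha> (Src C f) (Src C g) (Src C h) \<cdot> ((x \<otimes> \<one> (Src C h)) \<cdot> k))"
    using pre_cmp[OF *, of k] assms by auto
qed

lemma asc_inv_push_right:
  assumes "f \<in> Arr C" "g \<in> Arr C" "h \<in> Arr C" "x \<in> Arr C" "Tgt C x = Src C g \<odot> Src C h"
    "Tgt C f = a" "Tgt C g = b" "Tgt C h = c"
  shows "inv_arr C (\<alpha> a b c) \<cdot> (f \<otimes> ((g \<otimes> h) \<cdot> x))
      = (f \<otimes> g \<otimes> h) \<cdot> (inv_arr C (\<alpha> (Src C f) (Src C g) (Src C h)) \<cdot> (\<one> (Src C f) \<otimes> x))"
    and "\<lbrakk>k \<in> Arr C; Tgt C k = Src C f \<odot> Src C x\<rbrakk> \<Longrightarrow>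
      inv_arr C (\<alpha> a b c) \<cdot> ((f \<otimes> ((g \<otimes> h) \<cdot> x)) \<cdot> k)
      = (f \<otimes> g \<otimes> h) \<cdot> (inv_arr C (\<alpha> (Src C f) (Src C g) (Src C h)) \<cdot> ((\<one> (Src C f) \<otimes> x) \<cdot> k))"
proof -
  show *: "inv_arr C (\<alpha> a b c) \<cdot> (f \<otimes> ((g \<otimes> h) \<cdot> x))
      = (f \<otimes> g \<otimes> h) \<cdot> (inv_arr C (\<alpha> (Src C f) (Src C g) (Src C h)) \<cdot> (\<one> (Src C f) \<otimes> x))"
    using asc_inv_push(2)[of f g h a b c "\<one> (Src C f) \<otimes> x"] assms by simp
  show "\<lbrakk>k \<in> Arr C; Tgt C k = Src C f \<odot> Src C x\<rbrakk> \<Longrightarrow>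
      inv_arr C (\<alpha> a b c) \<cdot> ((f \<otimes> ((g \<otimes> h) \<cdot> x)) \<cdot> k)
      = (f \<otimes> g \<otimes> h) \<cdot> (inv_arr C (\<alpha> (Src C f) (Src C g) (Src C h)) \<cdot> ((\<one> (Src C f) \<otimes> x) \<cdot> k))"
    using pre_cmp[OF *, of k] assms by auto
qed

lemmas push = asc_push asc_inv_push asc_push_idn asc_inv_push_idn asc_push_left asc_inv_push_right

lemma lun_push:
  assumes "f \<in> Arr C" "Tgt C f = a"
  shows "\<lambda>\<lambda> a \<cdot> (\<one> \<K> \<otimes> f) = f \<cdot> \<lambda>\<lambda> (Src C f)"
    "\<lbrakk>k \<in> Arr C; Tgt C k = \<K> \<odot> Src C f\<rbrakk> \<Longrightarrow> \<lambda>\<lambda> a \<cdot> ((\<one> \<K> \<otimes> f) \<cdot> k) = f \<cdot> (\<lambda>\<lambda> (Src C f) \<cdot> k)"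
  using lun_nat_src[of f] pre_cmp[of "\<lambda>\<lambda> a" "\<one> \<K> \<otimes> f" "f \<cdot> \<lambda>\<lambda> (Src C f)" k] assms by auto

lemma run_push:
  assumes "f \<in> Arr C" "Tgt C f = a"
  shows "\<rho> a \<cdot> (f \<otimes> \<one> \<K>) = f \<cdot> \<rho> (Src C f)"
    "\<lbrakk>k \<in> Arr C; Tgt C k = Src C f \<odot> \<K>\<rbrakk> \<Longrightarrow> \<rho> a \<cdot> ((f \<otimes> \<one> \<K>) \<cdot> k) = f \<cdot> (\<rho> (Src C f) \<cdot> k)"
  using run_nat_src[of f] pre_cmp[of "\<rho> a" "f \<otimes> \<one> \<K>" "f \<cdot> \<rho> (Src C f)" k] assms by auto

end

section \<open>Coseparable comonoids\<close>

context monoidal_category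
begin

lemma comonoid_simps:
  assumes "comonoid C A d e"
  shows "A \<in> Obj C" "d \<in> Arr C" "Src C d = A" "Tgt C d = A \<odot> A" "e \<in> Arr C" "Src C e = A" "Tgt C e = \<K>"
  using assms by (simp_all add: comonoid_def hom_iff)

lemma comonoid_laws:
  assumes "comonoid C A d e"
  shows "\<alpha> A A A \<cdot> ((d \<otimes> \<one> A) \<cdot> d) = (\<one> A \<otimes> d) \<cdot> d"
    "\<lambda>\<lambda> A \<cdot> ((e \<otimes> \<one> A) \<cdot> d) = \<one> A" "\<rho> A \<cdot> ((\<one> A \<otimes> e) \<cdot> d) = \<one> A"
  using assms comonoid_simps[OF assms] by (simp_all add: comonoid_def)

text \<open>The extension operation of the coKleisli category of the comonad \<open>\<lambda>D. D \<odot> A\<close>.\<close>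

definition coext where "coext D A d g = (g \<otimes> \<one> A) \<cdot> (inv_arr C (\<alpha> D A A) \<cdot> (\<one> D \<otimes> d))"

lemma coext_simps:
  assumes "D \<in> Obj C" "A \<in> Obj C" "d \<in> Arr C" "Src C d = A" "Tgt C d = A \<odot> A"
    "g \<in> Arr C" "Src C g = D \<odot> A"
  shows "coext D A d g \<in> Arr C" "Src C (coext D A d g) = D \<odot> A" "Tgt C (coext D A d g) = Tgt C g \<odot> A"
  using assms by (simp_all add: coext_def)

lemma coext_cmp_left:
  assumes "D \<in> Obj C" "A \<in> Obj C" "d \<in> Arr C" "Src C d = A" "Tgt C d = A \<odot> A"
    "g \<in> Arr C" "Src C g = D \<odot> A" "f \<in> Arr C" "Src C f = Tgt C g"
  shows "coext D A d (f \<cdot> g) = (f \<otimes> \<one> A) \<cdot> coext D A d g"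
  using assms by (simp add: coext_def)

text \<open>Associativity of coKleisli composition. Naturality moves f and g aside; what remains is
  coassociativity of d tensored with D on the left, rebracketed by the pentagon.\<close>

lemma coext_coext:
  assumes A: "comonoid C A d e" and [simp]: "D \<in> Obj C"
    "g \<in> Arr C" "Src C g = D \<odot> A" "f \<in> Arr C" "Src C f = Tgt C g \<odot> A"
  shows "coext (Tgt C g) A d f \<cdot> coext D A d g = coext D A d (f \<cdot> coext D A d g)"
proof -
  note [simp] = comonoid_simps[OF A]
  let ?E = "Tgt C g"
  have "inv_arr C (\<alpha> (D \<odot> A) A A) \<cdot> ((\<one> (D \<odot> A) \<otimes> d) \<cdot> (inv_arr C (\<alpha> D A A) \<cdot> (\<one> D \<otimes> d)))
      = inv_arr C (\<alpha> (D \<odot> A) A A) \<cdot> (inv_arr C (\<alpha> D A (A \<odot> A)) \<cdot> (\<one> D \<otimes> ((\<one> A \<otimes> d) \<cdot> d)))"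
    by (simp add: push)
  also have "\<dots> = inv_arr C (\<alpha> (D \<odot> A) A A) \<cdot> (inv_arr C (\<alpha> D A (A \<odot> A)) \<cdot> ((\<one> D \<otimes> \<alpha> A A A) \<cdot> (\<one> D \<otimes> ((d \<otimes> \<one> A) \<cdot> d))))"
    using comonoid_laws(1)[OF A] by simp
  also have "\<dots> = (inv_arr C (\<alpha> D A A) \<otimes> \<one> A) \<cdot> (inv_arr C (\<alpha> D (A \<odot> A) A) \<cdot> (\<one> D \<otimes> ((d \<otimes> \<one> A) \<cdot> d)))"
    using pentagon_inv[of D A A A] pre_cmp[of "inv_arr C (\<alpha> (D \<odot> A) A A)" "inv_arr C (\<alpha> D A (A \<odot> A)) \<cdot> (\<one> D \<otimes> \<alpha> A A A)"
        "(inv_arr C (\<alpha> D A A) \<otimes> \<one> A) \<cdot> inv_arr C (\<alpha> D (A \<odot> A) A)" "\<one> D \<otimes> ((d \<otimes> \<one> A) \<cdot> d)"]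
    by (simp del: ten_merge)
  also have "\<dots> = ((inv_arr C (\<alpha> D A A) \<cdot> (\<one> D \<otimes> d)) \<otimes> \<one> A) \<cdot> (inv_arr C (\<alpha> D A A) \<cdot> (\<one> D \<otimes> d))"
    by (simp add: push)
  finally have *: "inv_arr C (\<alpha> (D \<odot> A) A A) \<cdot> ((\<one> (D \<odot> A) \<otimes> d) \<cdot> (inv_arr C (\<alpha> D A A) \<cdot> (\<one> D \<otimes> d)))
      = ((inv_arr C (\<alpha> D A A) \<cdot> (\<one> D \<otimes> d)) \<otimes> \<one> A) \<cdot> (inv_arr C (\<alpha> D A A) \<cdot> (\<one> D \<otimes> d))" .
  have "coext ?E A d f \<cdot> coext D A d g
     = (f \<otimes> \<one> A) \<cdot> (inv_arr C (\<alpha> ?E A A) \<cdot> ((g \<otimes> \<one> (A \<odot> A)) \<cdot> ((\<one> (D \<odot> A) \<otimes> d) \<cdot> (inv_arr C (\<alpha> D A A) \<cdot> (\<one> D \<otimes> d)))))"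
    by (simp add: coext_def)
  also have "\<dots> = (f \<otimes> \<one> A) \<cdot> (((g \<otimes> \<one> A) \<otimes> \<one> A) \<cdot> (inv_arr C (\<alpha> (D \<odot> A) A A) \<cdot> ((\<one> (D \<odot> A) \<otimes> d) \<cdot> (inv_arr C (\<alpha> D A A) \<cdot> (\<one> D \<otimes> d)))))"
    by (simp add: push del: ten_merge)
  also have "\<dots> = coext D A d (f \<cdot> coext D A d g)"
    unfolding * by (simp add: coext_def)
  finally show ?thesis .
qed

text \<open>The coKleisli identity extends to the identity: the triangle turns the claim into the
  left counit law.\<close>

lemma coext_counit:
  assumes A: "comonoid C A d e" and [simp]: "D \<in> Obj C"
  shows "coext D A d (\<rho> D \<cdot> (\<one> D \<otimes> e)) = \<one> (D \<odot> A)"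
proof -
  note [simp] = comonoid_simps[OF A]
  have "coext D A d (\<rho> D \<cdot> (\<one> D \<otimes> e))
      = (\<rho> D \<otimes> \<one> A) \<cdot> (((\<one> D \<otimes> e) \<otimes> \<one> A) \<cdot> (inv_arr C (\<alpha> D A A) \<cdot> (\<one> D \<otimes> d)))"
    by (simp add: coext_def)
  also have "\<dots> = (\<rho> D \<otimes> \<one> A) \<cdot> (inv_arr C (\<alpha> D \<K> A) \<cdot> (\<one> D \<otimes> ((e \<otimes> \<one> A) \<cdot> d)))"
    by (simp add: push)
  also have "\<dots> = (\<one> D \<otimes> \<lambda>\<lambda> A) \<cdot> (\<one> D \<otimes> ((e \<otimes> \<one> A) \<cdot> d))"
    by (rule pre_cmp[OF triangle_inv]) simp_all
  also have "\<dots> = \<one> (D \<odot> A)"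
    using comonoid_laws(2)[OF A] by simp
  finally show ?thesis .
qed

text \<open>The two sides of \<open>invariant\<close> are colinear for different reasons: the first
  is left colinear by coassociativity, the second is right colinear because it comes from an
  extension. Their equality gives one map with both properties.\<close>

lemma coseparableI:
  assumes A: "comonoid C A d e"
    and [simp]: "\<tau> \<in> Arr C" "Src C \<tau> = A \<odot> A" "Tgt C \<tau> = \<K>"
    and invariant: "\<rho> A \<cdot> ((\<one> A \<otimes> \<tau>) \<cdot> (\<alpha> A A A \<cdot> (d \<otimes> \<one> A))) = \<lambda>\<lambda> A \<cdot> coext A A d \<tau>"
    and counit: "\<tau> \<cdot> d = e"
  shows "coseparable C A d e"
proof -
  note [simp] = comonoid_simps[OF A]
  let ?p = "\<rho> A \<cdot> ((\<one> A \<otimes> \<tau>) \<cdot> (\<alpha> A A A \<cdot> (d \<otimes> \<one> A)))"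
  have right: "(?p \<otimes> \<one> A) \<cdot> (inv_arr C (\<alpha> A A A) \<cdot> (\<one> A \<otimes> d)) = d \<cdot> ?p"
  proof -
    have "(?p \<otimes> \<one> A) \<cdot> (inv_arr C (\<alpha> A A A) \<cdot> (\<one> A \<otimes> d)) = coext \<K> A d (\<lambda>\<lambda> A) \<cdot> coext A A d \<tau>"
      using coext_coext[OF A, of A \<tau> "\<lambda>\<lambda> A"] unfolding invariant by (simp add: coext_def)
    \<comment> \<open>Through \<open>\<lambda>\<lambda> A\<close> the cofree comodule on the unit is
      the regular one, so right colinearity is an instance of \<open>coext_coext\<close>.\<close>
    moreover have "coext \<K> A d (\<lambda>\<lambda> A) = d \<cdot> \<lambda>\<lambda> A"
      using pre_cmp[OF lun_asc_inv[of A A], of "\<one> \<K> \<otimes> d"] by (simp add: coext_def lun_push)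
    ultimately show ?thesis
      unfolding invariant by (simp add: coext_simps)
  qed
  have left: "(\<one> A \<otimes> ?p) \<cdot> (\<alpha> A A A \<cdot> (d \<otimes> \<one> A)) = d \<cdot> ?p"
  proof -
    have "(\<one> A \<otimes> ?p) \<cdot> (\<alpha> A A A \<cdot> (d \<otimes> \<one> A))
        = (\<one> A \<otimes> (\<rho> A \<cdot> (\<one> A \<otimes> \<tau>))) \<cdot> ((\<one> A \<otimes> \<alpha> A A A) \<cdot> ((\<one> A \<otimes> (d \<otimes> \<one> A)) \<cdot> (\<alpha> A A A \<cdot> (d \<otimes> \<one> A))))"
      by simp
    \<comment> \<open>Coassociativity puts both comultiplications on the left, and the pentagon
      trades the associators, so that the outer d can leave the scope of \<tau>.\<close>
    also have "(\<one> A \<otimes> (d \<otimes> \<one> A)) \<cdot> (\<alpha> A A A \<cdot> (d \<otimes> \<one> A)) = \<alpha> A (A \<odot> A) A \<cdot> (((\<one> A \<otimes> d) \<cdot> d) \<otimes> \<one> A)"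
      by (simp add: push)
    also have "\<dots> = \<alpha> A (A \<odot> A) A \<cdot> ((\<alpha> A A A \<otimes> \<one> A) \<cdot> (((d \<otimes> \<one> A) \<cdot> d) \<otimes> \<one> A))"
      unfolding comonoid_laws(1)[OF A, symmetric] by simp
    also have "(\<one> A \<otimes> \<alpha> A A A) \<cdot> \<dots> = \<alpha> A A (A \<odot> A) \<cdot> (\<alpha> (A \<odot> A) A A \<cdot> (((d \<otimes> \<one> A) \<cdot> d) \<otimes> \<one> A))"
      using pre_cmp[OF pentagon'[of A A A A], of "((d \<otimes> \<one> A) \<cdot> d) \<otimes> \<one> A"] by (simp del: ten_merge)
    also have "\<dots> = \<alpha> A A (A \<odot> A) \<cdot> ((d \<otimes> \<one> (A \<odot> A)) \<cdot> (\<alpha> A A A \<cdot> (d \<otimes> \<one> A)))"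
      by (simp add: push)
    also have "(\<one> A \<otimes> (\<rho> A \<cdot> (\<one> A \<otimes> \<tau>))) \<cdot> \<dots>
        = (\<one> A \<otimes> \<rho> A) \<cdot> (\<alpha> A A \<K> \<cdot> ((\<one> (A \<odot> A) \<otimes> \<tau>) \<cdot> ((d \<otimes> \<one> (A \<odot> A)) \<cdot> (\<alpha> A A A \<cdot> (d \<otimes> \<one> A)))))"
      using asc_push_idn(2)[of A A \<tau> \<K> "(d \<otimes> \<one> (A \<odot> A)) \<cdot> (\<alpha> A A A \<cdot> (d \<otimes> \<one> A))"] by simp
    also have "\<dots> = \<rho> (A \<odot> A) \<cdot> ((d \<otimes> \<one> \<K>) \<cdot> ((\<one> A \<otimes> \<tau>) \<cdot> (\<alpha> A A A \<cdot> (d \<otimes> \<one> A))))"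
      using pre_cmp[OF run_asc[of A A], of "(d \<otimes> \<tau>) \<cdot> (\<alpha> A A A \<cdot> (d \<otimes> \<one> A))"] by simp
    also have "\<dots> = d \<cdot> ?p"
      by (simp add: run_push del: ten_merge)
    finally show ?thesis .
  qed
  \<comment> \<open>In elements: \<open>b\<^sub>1 \<tau>(b\<^sub>2 \<otimes> b\<^sub>3) = b\<^sub>1
    e(b\<^sub>2) = b\<close>.\<close>
  have "?p \<cdot> d = \<rho> A \<cdot> ((\<one> A \<otimes> \<tau>) \<cdot> (\<alpha> A A A \<cdot> ((d \<otimes> \<one> A) \<cdot> d)))"
    by simp
  also have "\<dots> = \<one> A"
    unfolding comonoid_laws(1)[OF A] using comonoid_laws(3)[OF A] counit by simp
  finally have "?p \<cdot> d = \<one> A" .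
  with A left right show ?thesis
    unfolding coseparable_def bicomodule_hom_def by (intro conjI exI[of _ ?p]) (simp_all add: hom_iff)
qed

section \<open>From coseparability to a comodule retraction\<close>

lemma run_inv_nat:
  assumes "f \<in> Arr C" "Tgt C f = a"
  shows "inv_arr C (\<rho> a) \<cdot> f = (f \<otimes> \<one> \<K>) \<cdot> inv_arr C (\<rho> (Src C f))"
  by (rule iso_cancel_left[of "\<rho> a"]) (use assms in \<open>auto simp: run_push\<close>)

lemma asc_inv_unt:
  assumes [simp]: "a \<in> Obj C" "b \<in> Obj C"
  shows "inv_arr C (\<alpha> a \<K> b) \<cdot> (\<one> a \<otimes> inv_arr C (\<lambda>\<lambda> b)) = inv_arr C (\<rho> a) \<otimes> \<one> b"
proof (rule iso_cancel_left[rotated -1])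
  show "(\<rho> a \<otimes> \<one> b) \<cdot> (inv_arr C (\<alpha> a \<K> b) \<cdot> (\<one> a \<otimes> inv_arr C (\<lambda>\<lambda> b)))
      = (\<rho> a \<otimes> \<one> b) \<cdot> (inv_arr C (\<rho> a) \<otimes> \<one> b)"
    using pre_cmp[OF triangle_inv[of a b], of "\<one> a \<otimes> inv_arr C (\<lambda>\<lambda> b)"] by simp
qed (simp_all add: iso_ten)

text \<open>With 1 written for g, the value \<open>p(b \<otimes> 1)\<close> is computed twice from
  its comultiplication. The counit on the right leg and left colinearity give
  \<open>b\<^sub>1 \<theta>(b\<^sub>2)\<close>; the counit on the left leg and right colinearity
  give \<open>\<theta>(b) 1\<close>.\<close>

lemma coseparable_comodule_retraction:
  assumes cosep: "coseparable C A d e"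
    and g: "comonoid_hom C \<K> (unit_comult C) (unit_counit C) A d e g"
  shows "\<exists>\<theta>\<in>hom C A \<K>. \<rho> A \<cdot> (\<one> A \<otimes> \<theta>) \<cdot> d = g \<cdot> \<theta> \<and> \<theta> \<cdot> g = \<one> \<K>"
proof -
  have A: "comonoid C A d e"
    using cosep by (simp add: coseparable_def)
  note [simp] = comonoid_simps[OF A]
  have [simp]: "g \<in> Arr C" "Src C g = \<K>" "Tgt C g = A" and dg: "d \<cdot> g = (g \<otimes> g) \<cdot> inv_arr C (\<lambda>\<lambda> \<K>)"
    and eg: "e \<cdot> g = \<one> \<K>"
    using g by (simp_all add: comonoid_hom_def hom_iff unit_comult_def unit_counit_def)
  obtain p where [simp]: "p \<in> Arr C" "Src C p = A \<odot> A" "Tgt C p = A"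
    and left: "d \<cdot> p = (\<one> A \<otimes> p) \<cdot> (\<alpha> A A A \<cdot> (d \<otimes> \<one> A))"
    and right: "d \<cdot> p = (p \<otimes> \<one> A) \<cdot> (inv_arr C (\<alpha> A A A) \<cdot> (\<one> A \<otimes> d))"
    and pd: "p \<cdot> d = \<one> A"
    using cosep by (auto simp: coseparable_def bicomodule_hom_def hom_iff)
  \<comment> \<open>The form \<open>e \<cdot> p\<close> with g inserted in its second argument; the
    inverse of \<open>\<rho> A\<close> creates the unit factor on which g acts.\<close>
  define \<theta> where "\<theta> = e \<cdot> (p \<cdot> ((\<one> A \<otimes> g) \<cdot> inv_arr C (\<rho> A)))"
  have [simp]: "\<theta> \<in> Arr C" "Src C \<theta> = A" "Tgt C \<theta> = \<K>"
    by (simp_all add: \<theta>_def)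
  have \<theta>\<rho>: "e \<cdot> (p \<cdot> (\<one> A \<otimes> g)) = \<theta> \<cdot> \<rho> A"
    by (simp add: \<theta>_def)
  have "p \<cdot> (\<one> A \<otimes> g) = \<rho> A \<cdot> ((\<one> A \<otimes> e) \<cdot> (d \<cdot> (p \<cdot> (\<one> A \<otimes> g))))"
    using pre_cmp[of "\<rho> A" "(\<one> A \<otimes> e) \<cdot> d" "\<one> A" "p \<cdot> (\<one> A \<otimes> g)"] comonoid_laws(3)[OF A] by simp
  also have "d \<cdot> (p \<cdot> (\<one> A \<otimes> g)) = (\<one> A \<otimes> p) \<cdot> (\<alpha> A A A \<cdot> ((\<one> (A \<odot> A) \<otimes> g) \<cdot> (d \<otimes> \<one> \<K>)))"
    using pre_cmp[OF left, of "\<one> A \<otimes> g"] by simp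
  also have "\<dots> = (\<one> A \<otimes> (p \<cdot> (\<one> A \<otimes> g))) \<cdot> (\<alpha> A A \<K> \<cdot> (d \<otimes> \<one> \<K>))"
    by (simp add: asc_push_idn del: ten_merge) simp
  also have "\<rho> A \<cdot> ((\<one> A \<otimes> e) \<cdot> \<dots>) = \<rho> A \<cdot> ((\<one> A \<otimes> \<theta>) \<cdot> ((\<one> A \<otimes> \<rho> A) \<cdot> (\<alpha> A A \<K> \<cdot> (d \<otimes> \<one> \<K>))))"
    by (simp add: \<theta>\<rho>)
  also have "\<dots> = \<rho> A \<cdot> ((\<one> A \<otimes> \<theta>) \<cdot> (d \<cdot> \<rho> A))"
    using pre_cmp[OF run_asc[of A A], of "d \<otimes> \<one> \<K>"] by (simp add: run_push del: ten_merge)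
  finally have L: "p \<cdot> (\<one> A \<otimes> g) = (\<rho> A \<cdot> ((\<one> A \<otimes> \<theta>) \<cdot> d)) \<cdot> \<rho> A"
    by simp
  have "p \<cdot> (\<one> A \<otimes> g) = \<lambda>\<lambda> A \<cdot> ((e \<otimes> \<one> A) \<cdot> (d \<cdot> (p \<cdot> (\<one> A \<otimes> g))))"
    using pre_cmp[of "\<lambda>\<lambda> A" "(e \<otimes> \<one> A) \<cdot> d" "\<one> A" "p \<cdot> (\<one> A \<otimes> g)"] comonoid_laws(2)[OF A] by simp
  also have "d \<cdot> (p \<cdot> (\<one> A \<otimes> g)) = (p \<otimes> \<one> A) \<cdot> (inv_arr C (\<alpha> A A A) \<cdot> (\<one> A \<otimes> ((g \<otimes> g) \<cdot> inv_arr C (\<lambda>\<lambda> \<K>))))"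
    using pre_cmp[OF right, of "\<one> A \<otimes> g"] dg by simp
  \<comment> \<open>Since g is group-like, one copy of g enters p and the other becomes the right
    leg.\<close>
  also have "\<dots> = ((p \<cdot> (\<one> A \<otimes> g)) \<otimes> g) \<cdot> (inv_arr C (\<rho> A) \<otimes> \<one> \<K>)"
    using asc_inv_unt[of A \<K>] by (simp add: push)
  also have "\<lambda>\<lambda> A \<cdot> ((e \<otimes> \<one> A) \<cdot> \<dots>) = \<lambda>\<lambda> A \<cdot> ((\<one> \<K> \<otimes> g) \<cdot> (\<theta> \<otimes> \<one> \<K>))"
    by (simp add: \<theta>_def)
  also have "\<dots> = (g \<cdot> \<theta>) \<cdot> \<rho> A"
    by (simp add: lun_push lun_unt run_push del: ten_merge)
  finally have "(\<rho> A \<cdot> ((\<one> A \<otimes> \<theta>) \<cdot> d)) \<cdot> \<rho> A = (g \<cdot> \<theta>) \<cdot> \<rho> A"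
    using L by simp
  then have "\<rho> A \<cdot> ((\<one> A \<otimes> \<theta>) \<cdot> d) = g \<cdot> \<theta>"
    by (rule iso_cancel_right[rotated -1]) simp_all
  \<comment> \<open>Now both arguments of p are g, and the pair of them is
    \<open>d \<cdot> g\<close>, to which the retraction property applies.\<close>
  moreover have "\<theta> \<cdot> g = e \<cdot> (p \<cdot> (d \<cdot> g))"
    by (simp add: \<theta>_def run_inv_nat dg lun_unt)
  then have "\<theta> \<cdot> g = \<one> \<K>"
    using pre_cmp[OF pd, of g] eg by simp
  ultimately show ?thesis
    by (intro bexI[of _ \<theta>]) (simp_all add: hom_iff)
qed

end

section \<open>Exchange isomorphisms and Hopf categories\<close>

context braided_monoidal_category
begin

lemma brd_push:
  assumes "f \<in> Arr C" "g \<in> Arr C" "Tgt C f = a" "Tgt C g = b"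
  shows "\<c> a b \<cdot> (f \<otimes> g) = (g \<otimes> f) \<cdot> \<c> (Src C f) (Src C g)"
  using brd_nat_src[of f g] assms by simp

text \<open>The part of \<open>middle_exchange\<close> to the right of its first factor. Isolating
  it allows coherence with further factors to be proved before the first factor is tensored
  on.\<close>

definition left_exchange
  where "left_exchange b c d = \<alpha> c b d \<cdot> ((\<c> b c \<otimes> \<one> d) \<cdot> inv_arr C (\<alpha> b c d))"

lemma left_exchange_simps [simp]:
  assumes "b \<in> Obj C" "c \<in> Obj C" "d \<in> Obj C"
  shows "left_exchange b c d \<in> Arr C" "Src C (left_exchange b c d) = b \<odot> (c \<odot> d)"
    "Tgt C (left_exchange b c d) = c \<odot> (b \<odot> d)"
  using assms by (simp_all add: left_exchange_def)

lemma middle_exchange_eq: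
  assumes "a \<in> Obj C" "b \<in> Obj C" "c \<in> Obj C" "d \<in> Obj C"
  shows "middle_exchange C a b c d
    = inv_arr C (\<alpha> a c (b \<odot> d)) \<cdot> ((\<one> a \<otimes> left_exchange b c d) \<cdot> \<alpha> a b (c \<odot> d))"
  using assms by (simp add: middle_exchange_def left_exchange_def)

lemma middle_exchange_simps [simp]:
  assumes "a \<in> Obj C" "b \<in> Obj C" "c \<in> Obj C" "d \<in> Obj C"
  shows "middle_exchange C a b c d \<in> Arr C" "Src C (middle_exchange C a b c d) = a \<odot> b \<odot> (c \<odot> d)"
    "Tgt C (middle_exchange C a b c d) = a \<odot> c \<odot> (b \<odot> d)"
  using assms by (simp_all add: middle_exchange_eq)

lemma left_exchange_nat:
  assumes "f \<in> Arr C" "g \<in> Arr C" "h \<in> Arr C" "Tgt C f = b" "Tgt C g = c" "Tgt C h = d"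
  shows "left_exchange b c d \<cdot> (f \<otimes> (g \<otimes> h))
    = (g \<otimes> (f \<otimes> h)) \<cdot> left_exchange (Src C f) (Src C g) (Src C h)"
proof -
  note [simp] = assms(4-6)[symmetric]
  show ?thesis
    using assms(1-3) by (simp add: left_exchange_def push brd_push)
qed

lemma middle_exchange_nat:
  assumes [simp]: "f \<in> Arr C" "g \<in> Arr C" "h \<in> Arr C" "k \<in> Arr C"
    and t: "Tgt C f = a" "Tgt C g = b" "Tgt C h = c" "Tgt C k = d"
  shows "middle_exchange C a b c d \<cdot> (f \<otimes> g \<otimes> (h \<otimes> k))
    = (f \<otimes> h \<otimes> (g \<otimes> k)) \<cdot> middle_exchange C (Src C f) (Src C g) (Src C h) (Src C k)"
proof -
  note [simp] = t[symmetric]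
  have "middle_exchange C a b c d \<cdot> (f \<otimes> g \<otimes> (h \<otimes> k))
     = inv_arr C (\<alpha> a c (b \<odot> d)) \<cdot> ((f \<otimes> (h \<otimes> (g \<otimes> k)))
         \<cdot> ((\<one> (Src C f) \<otimes> left_exchange (Src C g) (Src C h) (Src C k)) \<cdot> \<alpha> (Src C f) (Src C g) (Src C h \<odot> Src C k)))"
    by (simp add: middle_exchange_eq push left_exchange_nat)
  also have "\<dots> = (f \<otimes> h \<otimes> (g \<otimes> k)) \<cdot> middle_exchange C (Src C f) (Src C g) (Src C h) (Src C k)"
    by (simp add: middle_exchange_eq push del: ten_merge)
  finally show ?thesis .
qed

text \<open>The triangle turns the associator into a right unit constraint, and
  \<open>run_brd\<close> then absorbs the braiding with the unit.\<close>

lemma left_exchange_unt: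
  assumes [simp]: "b \<in> Obj C" "d \<in> Obj C"
  shows "(\<one> b \<otimes> \<lambda>\<lambda> d) \<cdot> left_exchange \<K> b d = \<lambda>\<lambda> (b \<odot> d)"
proof -
  have "(\<one> b \<otimes> \<lambda>\<lambda> d) \<cdot> left_exchange \<K> b d
      = (\<rho> b \<otimes> \<one> d) \<cdot> ((\<c> \<K> b \<otimes> \<one> d) \<cdot> inv_arr C (\<alpha> \<K> b d))"
    unfolding left_exchange_def by (rule pre_cmp[OF triangle]) simp_all
  also have "\<dots> = \<lambda>\<lambda> (b \<odot> d)"
    by (simp add: run_brd lun_asc_inv)
  finally show ?thesis .
qed

text \<open>Once \<theta> has turned the second factor into the unit, this removes the exchange from
  the invariance computation.\<close>

lemma middle_exchange_unt:
  assumes [simp]: "a \<in> Obj C" "b \<in> Obj C" "d \<in> Obj C"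
  shows "(\<one> (a \<odot> b) \<otimes> \<lambda>\<lambda> d) \<cdot> middle_exchange C a \<K> b d = inv_arr C (\<alpha> a b d) \<cdot> (\<rho> a \<otimes> \<one> (b \<odot> d))"
proof -
  have "(\<one> (a \<odot> b) \<otimes> \<lambda>\<lambda> d) \<cdot> middle_exchange C a \<K> b d
      = ((\<one> a \<otimes> \<one> b) \<otimes> \<lambda>\<lambda> d) \<cdot> (inv_arr C (\<alpha> a b (\<K> \<odot> d)) \<cdot> ((\<one> a \<otimes> left_exchange \<K> b d) \<cdot> \<alpha> a \<K> (b \<odot> d)))"
    by (simp add: middle_exchange_eq)
  also have "\<dots> = inv_arr C (\<alpha> a b d) \<cdot> ((\<one> a \<otimes> (\<one> b \<otimes> \<lambda>\<lambda> d)) \<cdot> ((\<one> a \<otimes> left_exchange \<K> b d) \<cdot> \<alpha> a \<K> (b \<odot> d)))"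
    by (simp add: asc_inv_push del: ten_merge)
  also have "\<dots> = inv_arr C (\<alpha> a b d) \<cdot> (\<rho> a \<otimes> \<one> (b \<odot> d))"
    by (simp add: left_exchange_unt triangle)
  finally show ?thesis .
qed

text \<open>The factor e is a spectator and only b and c are braided, so two pentagons and
  naturality of \<alpha> at the braiding suffice.\<close>

lemma left_exchange_asc:
  assumes [simp]: "b \<in> Obj C" "c \<in> Obj C" "d \<in> Obj C" "e \<in> Obj C"
  shows "left_exchange b c (d \<odot> e) \<cdot> ((\<one> b \<otimes> \<alpha> c d e) \<cdot> \<alpha> b (c \<odot> d) e)
    = (\<one> c \<otimes> \<alpha> b d e) \<cdot> (\<alpha> c (b \<odot> d) e \<cdot> (left_exchange b c d \<otimes> \<one> e))"
proof -
  have "inv_arr C (\<alpha> b c (d \<odot> e)) \<cdot> ((\<one> b \<otimes> \<alpha> c d e) \<cdot> \<alpha> b (c \<odot> d) e)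
      = \<alpha> (b \<odot> c) d e \<cdot> (inv_arr C (\<alpha> b c d) \<otimes> \<one> e)"
  proof (rule iso_cancel_right[rotated -1])
    show "(inv_arr C (\<alpha> b c (d \<odot> e)) \<cdot> ((\<one> b \<otimes> \<alpha> c d e) \<cdot> \<alpha> b (c \<odot> d) e)) \<cdot> (\<alpha> b c d \<otimes> \<one> e)
      = (\<alpha> (b \<odot> c) d e \<cdot> (inv_arr C (\<alpha> b c d) \<otimes> \<one> e)) \<cdot> (\<alpha> b c d \<otimes> \<one> e)"
      by (simp add: pentagon')
  qed (simp_all add: iso_ten)
  then have "left_exchange b c (d \<odot> e) \<cdot> ((\<one> b \<otimes> \<alpha> c d e) \<cdot> \<alpha> b (c \<odot> d) e)
     = \<alpha> c b (d \<odot> e) \<cdot> ((\<c> b c \<otimes> \<one> (d \<odot> e)) \<cdot> (\<alpha> (b \<odot> c) d e \<cdot> (inv_arr C (\<alpha> b c d) \<otimes> \<one> e)))"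
    by (simp add: left_exchange_def)
  also have "\<dots> = \<alpha> c b (d \<odot> e) \<cdot> (\<alpha> (c \<odot> b) d e \<cdot> ((\<c> b c \<otimes> \<one> d \<otimes> \<one> e) \<cdot> (inv_arr C (\<alpha> b c d) \<otimes> \<one> e)))"
    by (simp add: asc_push del: ten_merge)
  also have "\<dots> = (\<one> c \<otimes> \<alpha> b d e) \<cdot> (\<alpha> c (b \<odot> d) e \<cdot> ((\<alpha> c b d \<otimes> \<one> e) \<cdot> ((\<c> b c \<otimes> \<one> d \<otimes> \<one> e) \<cdot> (inv_arr C (\<alpha> b c d) \<otimes> \<one> e))))"
    using pre_cmp[OF pentagon'[of c b d e], of "(\<c> b c \<otimes> \<one> d \<otimes> \<one> e) \<cdot> (inv_arr C (\<alpha> b c d) \<otimes> \<one> e)"]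
    by (simp del: ten_merge)
  also have "\<dots> = (\<one> c \<otimes> \<alpha> b d e) \<cdot> (\<alpha> c (b \<odot> d) e \<cdot> (left_exchange b c d \<otimes> \<one> e))"
    by (simp add: left_exchange_def)
  finally show ?thesis .
qed

text \<open>A spectator to the right of an exchange is absorbed into its fourth argument. The
  pentagon brings the associators under the identity of the first factor, where
  \<open>left_exchange_asc\<close> applies.\<close>

lemma middle_exchange_asc:
  assumes [simp]: "a \<in> Obj C" "b \<in> Obj C" "c \<in> Obj C" "d \<in> Obj C" "e \<in> Obj C"
  shows "\<alpha> (a \<odot> c) (b \<odot> d) e \<cdot> (middle_exchange C a b c d \<otimes> \<one> e)
    = (\<one> (a \<odot> c) \<otimes> inv_arr C (\<alpha> b d e)) \<cdot> (middle_exchange C a b c (d \<odot> e) \<cdot> ((\<one> (a \<odot> b) \<otimes> \<alpha> c d e) \<cdot> \<alpha> (a \<odot> b) (c \<odot> d) e))"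
proof -
  have "middle_exchange C a b c (d \<odot> e) \<cdot> ((\<one> (a \<odot> b) \<otimes> \<alpha> c d e) \<cdot> \<alpha> (a \<odot> b) (c \<odot> d) e)
     = inv_arr C (\<alpha> a c (b \<odot> (d \<odot> e))) \<cdot> ((\<one> a \<otimes> left_exchange b c (d \<odot> e)) \<cdot> ((\<one> a \<otimes> (\<one> b \<otimes> \<alpha> c d e)) \<cdot> (\<alpha> a b (c \<odot> d \<odot> e) \<cdot> \<alpha> (a \<odot> b) (c \<odot> d) e)))"
    by (simp add: middle_exchange_eq push)
  also have "\<dots> = inv_arr C (\<alpha> a c (b \<odot> (d \<odot> e))) \<cdot> ((\<one> a \<otimes> (left_exchange b c (d \<odot> e) \<cdot> ((\<one> b \<otimes> \<alpha> c d e) \<cdot> \<alpha> b (c \<odot> d) e)))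
        \<cdot> (\<alpha> a (b \<odot> (c \<odot> d)) e \<cdot> (\<alpha> a b (c \<odot> d) \<otimes> \<one> e)))"
    unfolding pentagon'[of a b "c \<odot> d" e, simplified, symmetric] by simp
  also have "\<dots> = inv_arr C (\<alpha> a c (b \<odot> (d \<odot> e))) \<cdot> ((\<one> a \<otimes> (\<one> c \<otimes> \<alpha> b d e)) \<cdot> ((\<one> a \<otimes> \<alpha> c (b \<odot> d) e)
        \<cdot> ((\<one> a \<otimes> (left_exchange b c d \<otimes> \<one> e)) \<cdot> (\<alpha> a (b \<odot> (c \<odot> d)) e \<cdot> (\<alpha> a b (c \<odot> d) \<otimes> \<one> e)))))"
    unfolding left_exchange_asc[OF assms(2-)] by simp
  also have "\<dots> = (\<one> (a \<odot> c) \<otimes> \<alpha> b d e) \<cdot> (inv_arr C (\<alpha> a c (b \<odot> d \<odot> e)) \<cdot> ((\<one> a \<otimes> \<alpha> c (b \<odot> d) e)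
        \<cdot> (\<alpha> a (c \<odot> (b \<odot> d)) e \<cdot> (((\<one> a \<otimes> left_exchange b c d) \<otimes> \<one> e) \<cdot> (\<alpha> a b (c \<odot> d) \<otimes> \<one> e)))))"
    by (simp add: asc_push asc_inv_push del: ten_merge)
  also have "inv_arr C (\<alpha> a c (b \<odot> d \<odot> e)) \<cdot> ((\<one> a \<otimes> \<alpha> c (b \<odot> d) e)
        \<cdot> (\<alpha> a (c \<odot> (b \<odot> d)) e \<cdot> (((\<one> a \<otimes> left_exchange b c d) \<otimes> \<one> e) \<cdot> (\<alpha> a b (c \<odot> d) \<otimes> \<one> e))))
      = inv_arr C (\<alpha> a c (b \<odot> d \<odot> e)) \<cdot> (((\<one> a \<otimes> \<alpha> c (b \<odot> d) e) \<cdot> (\<alpha> a (c \<odot> (b \<odot> d)) e \<cdot> (\<alpha> a c (b \<odot> d) \<otimes> \<one> e)))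
         \<cdot> (middle_exchange C a b c d \<otimes> \<one> e))"
    by (simp add: middle_exchange_eq)
  also have "\<dots> = \<alpha> (a \<odot> c) (b \<odot> d) e \<cdot> (middle_exchange C a b c d \<otimes> \<one> e)"
    unfolding pentagon'[of a c "b \<odot> d" e, simplified] by simp
  finally show ?thesis
    by simp
qed

text \<open>With m written as a product, both sides send \<open>h \<otimes> b\<close> to
  \<open>h\<^sub>1 b\<^sub>1 \<otimes> (h\<^sub>2 b\<^sub>2 \<otimes> b\<^sub>3)\<close>.
  Multiplicativity of the comultiplication produces the exchange, and coassociativity in B regroups
  the three legs of b.\<close>

lemma comonoid_hom_coext:
  assumes A: "comonoid C A d e" and B: "comonoid C B d' e'"
    and m: "comonoid_hom C (A \<odot> B) (tensor_comult C A d B d') (tensor_counit C e e') B d' e' m"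
  shows "\<alpha> B B B \<cdot> ((d' \<otimes> \<one> B) \<cdot> coext A B d' m)
    = (m \<otimes> coext A B d' m) \<cdot> (middle_exchange C A A B B \<cdot> (d \<otimes> d'))"
proof -
  note [simp] = comonoid_simps[OF A] comonoid_simps[OF B]
  have [simp]: "m \<in> Arr C" "Src C m = A \<odot> B" "Tgt C m = B"
    and dm: "d' \<cdot> m = (m \<otimes> m) \<cdot> (middle_exchange C A A B B \<cdot> (d \<otimes> d'))"
    using m by (simp_all add: comonoid_hom_def hom_iff tensor_comult_def)
  let ?M = "middle_exchange C A A B B" and ?M' = "middle_exchange C A A B (B \<odot> B)"
    and ?a = "inv_arr C (\<alpha> (A \<odot> A) (B \<odot> B) B)"
  have "(d' \<otimes> \<one> B) \<cdot> coext A B d' m = ((d' \<cdot> m) \<otimes> \<one> B) \<cdot> (inv_arr C (\<alpha> A B B) \<cdot> (\<one> A \<otimes> d'))"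
    by (simp add: coext_def)
  also have "\<dots> = (m \<otimes> m \<otimes> \<one> B) \<cdot> ((?M \<otimes> \<one> B) \<cdot> ((d \<otimes> d' \<otimes> \<one> B) \<cdot> (inv_arr C (\<alpha> A B B) \<cdot> (\<one> A \<otimes> d'))))"
    unfolding dm by simp
  also have "(d \<otimes> d' \<otimes> \<one> B) \<cdot> (inv_arr C (\<alpha> A B B) \<cdot> (\<one> A \<otimes> d')) = ?a \<cdot> (d \<otimes> ((d' \<otimes> \<one> B) \<cdot> d'))"
    by (simp add: push)
  also have "(d' \<otimes> \<one> B) \<cdot> d' = inv_arr C (\<alpha> B B B) \<cdot> ((\<one> B \<otimes> d') \<cdot> d')"
    unfolding comonoid_laws(1)[OF B, symmetric] by simp
  finally have "\<alpha> B B B \<cdot> ((d' \<otimes> \<one> B) \<cdot> coext A B d' m)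
     = (m \<otimes> (m \<otimes> \<one> B)) \<cdot> ((\<alpha> (A \<odot> B) (A \<odot> B) B \<cdot> (?M \<otimes> \<one> B))
         \<cdot> (?a \<cdot> (d \<otimes> (inv_arr C (\<alpha> B B B) \<cdot> ((\<one> B \<otimes> d') \<cdot> d')))))"
    by (simp add: push)
  \<comment> \<open>Two associators from \<open>middle_exchange_asc\<close> cancel: one against
    \<open>?a\<close>, the other against the one just introduced by coassociativity.\<close>
  also have "(\<alpha> (A \<odot> B) (A \<odot> B) B \<cdot> (?M \<otimes> \<one> B)) \<cdot> (?a \<cdot> (d \<otimes> (inv_arr C (\<alpha> B B B) \<cdot> ((\<one> B \<otimes> d') \<cdot> d'))))
     = (\<one> (A \<odot> B) \<otimes> inv_arr C (\<alpha> A B B)) \<cdot> (?M' \<cdot> ((\<one> A \<otimes> \<one> A \<otimes> (\<one> B \<otimes> d')) \<cdot> (d \<otimes> d')))"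
    by (simp add: middle_exchange_asc)
  also have "?M' \<cdot> ((\<one> A \<otimes> \<one> A \<otimes> (\<one> B \<otimes> d')) \<cdot> (d \<otimes> d')) = (\<one> (A \<odot> B) \<otimes> (\<one> A \<otimes> d')) \<cdot> (?M \<cdot> (d \<otimes> d'))"
    using pre_cmp[OF middle_exchange_nat[of "\<one> A" "\<one> A" "\<one> B" d'], of A A B "B \<odot> B" "d \<otimes> d'"] by simp
  finally show ?thesis
    by (simp add: coext_def)
qed

end

section \<open>From a comodule retraction to coseparability of the hom objects\<close>

context hopf_category
begin

lemma mult_simps [simp]:
  assumes "x \<in> X" "y \<in> X" "z \<in> X"
  shows "\<mu> x y z \<in> Arr C" "Src C (\<mu> x y z) = a x y \<odot> a y z" "Tgt C (\<mu> x y z) = a x z"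
  using mult_comonoid_hom[OF assms] by (simp_all add: comonoid_hom_def hom_iff)

lemma unit_simps [simp]:
  assumes "x \<in> X"
  shows "\<eta> x \<in> Arr C" "Src C (\<eta> x) = \<K>" "Tgt C (\<eta> x) = a x x"
  using unit_comonoid_hom[OF assms] by (simp_all add: comonoid_hom_def hom_iff)

lemma hom_comonoid_simps [simp]:
  assumes "x \<in> X" "y \<in> X"
  shows "a x y \<in> Obj C" "\<delta> x y \<in> Arr C" "Src C (\<delta> x y) = a x y" "Tgt C (\<delta> x y) = a x y \<odot> a x y"
    "\<epsilon> x y \<in> Arr C" "Src C (\<epsilon> x y) = a x y" "Tgt C (\<epsilon> x y) = \<K>"
  using comonoid_simps[OF hom_comonoid[OF assms]] by blast+

text \<open>
  The invariance of \<open>\<tau> = \<theta> \<cdot> \<mu> \<cdot> (1 \<otimes> \<sigma>)\<close> is tested after composition with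
  \<open>h \<otimes> b \<mapsto> h b\<^sub>1 \<otimes> b\<^sub>2\<close>, a split epimorphism with section \<open>b \<otimes> b' \<mapsto> b \<sigma>(b'\<^sub>1) \<otimes> b'\<^sub>2\<close>. Both sides
  become \<open>h \<otimes> b \<mapsto> \<theta>(h) b\<close>, and no property of \<open>\<sigma>\<close> with respect to \<open>\<delta>\<close> is needed.
\<close>

lemma comodule_retraction_coseparable:
  assumes [simp]: "x \<in> X" "y \<in> X"
    and \<theta>: "\<theta> \<in> hom C (a x x) \<K>" "\<rho> (a x x) \<cdot> (\<one> (a x x) \<otimes> \<theta>) \<cdot> \<delta> x x = \<eta> x \<cdot> \<theta>" "\<theta> \<cdot> \<eta> x = \<one> \<K>"
  shows "coseparable C (a x y) (\<delta> x y) (\<epsilon> x y)"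
proof -
  obtain S where S: "S \<in> hom C (a x y) (a y x)"
    "\<mu> x y x \<cdot> (\<one> (a x y) \<otimes> S) \<cdot> \<delta> x y = \<eta> x \<cdot> \<epsilon> x y"
    "\<mu> y x y \<cdot> (S \<otimes> \<one> (a x y)) \<cdot> \<delta> x y = \<eta> y \<cdot> \<epsilon> x y"
    using antipode assms(1,2) by blast
  define H B B' \<nu> m d e where defs: "H = a x x" "B = a x y" "B' = a y x" "\<nu> = \<mu> x y x" "m = \<mu> x x y"
    "d = \<delta> x y" "e = \<epsilon> x y"
  have [simp]: "S \<in> Arr C" "Src C S = B" "Tgt C S = B'" "H \<in> Obj C" "B \<in> Obj C" "B' \<in> Obj C"
    "\<nu> \<in> Arr C" "Src C \<nu> = B \<odot> B'" "Tgt C \<nu> = H" "m \<in> Arr C" "Src C m = H \<odot> B" "Tgt C m = B"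
    "\<theta> \<in> Arr C" "Src C \<theta> = H" "Tgt C \<theta> = \<K>" "\<delta> x x \<in> Arr C" "Src C (\<delta> x x) = H" "Tgt C (\<delta> x x) = H \<odot> H"
    "\<eta> x \<in> Arr C" "Src C (\<eta> x) = \<K>" "Tgt C (\<eta> x) = H" "\<eta> y \<in> Arr C" "Src C (\<eta> y) = \<K>" "Tgt C (\<eta> y) = a y y"
    using S(1) \<theta>(1) by (simp_all add: hom_iff defs)
  have B: "comonoid C B d e"
    by (simp add: defs hom_comonoid)
  note [simp] = comonoid_simps[OF B]
  have antipode_right: "\<nu> \<cdot> ((\<one> B \<otimes> S) \<cdot> d) = \<eta> x \<cdot> e"
    using S(2) by (simp add: defs hom_iff del: ten_merge)
  have antipode_left: "\<mu> y x y \<cdot> ((S \<otimes> \<one> B) \<cdot> d) = \<eta> y \<cdot> e"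
    using S by (simp add: defs hom_iff del: ten_merge)
  have invariant: "\<rho> H \<cdot> ((\<one> H \<otimes> \<theta>) \<cdot> \<delta> x x) = \<eta> x \<cdot> \<theta>"
    using \<theta>(2) by (simp add: defs(1))
  let ?S = "\<nu> \<cdot> (\<one> B \<otimes> S)"
  define \<tau> where "\<tau> = \<theta> \<cdot> ?S"
  have [simp]: "\<tau> \<in> Arr C" "Src C \<tau> = B \<odot> B" "Tgt C \<tau> = \<K>"
    by (simp_all add: \<tau>_def)
  define \<kappa> where "\<kappa> = coext H B d m"
  have [simp]: "\<kappa> \<in> Arr C" "Src C \<kappa> = H \<odot> B" "Tgt C \<kappa> = B \<odot> B"
    by (simp_all add: \<kappa>_def coext_simps)
  \<comment> \<open>In elements:
    \<open>(b \<sigma>(b'\<^sub>1)) b'\<^sub>2 = b \<epsilon>(b')\<close>, by associativity and the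
    antipode identity at y.\<close>
  have m_S: "m \<cdot> coext B B d ?S = \<rho> B \<cdot> (\<one> B \<otimes> e)"
  proof -
    have "m \<cdot> coext B B d ?S = (m \<cdot> (\<nu> \<otimes> \<one> B)) \<cdot> (inv_arr C (\<alpha> B B' B) \<cdot> (\<one> B \<otimes> ((S \<otimes> \<one> B) \<cdot> d)))"
      by (simp add: coext_def push)
    also have "m \<cdot> (\<nu> \<otimes> \<one> B) = \<mu> x y y \<cdot> ((\<one> B \<otimes> \<mu> y x y) \<cdot> \<alpha> B B' B)"
      using mult_assoc[of x y x y] by (simp add: defs)
    finally have "m \<cdot> coext B B d ?S = \<mu> x y y \<cdot> (\<one> B \<otimes> (\<mu> y x y \<cdot> ((S \<otimes> \<one> B) \<cdot> d)))"
      using defs by simp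
    then show ?thesis
      unfolding antipode_left using pre_cmp[OF mult_unit_right[of x y], of "\<one> B \<otimes> e"] defs(2) by simp
  qed
  \<comment> \<open>In elements: \<open>(h b\<^sub>1) \<sigma>(b\<^sub>2) = h \<epsilon>(b)\<close>,
    by associativity and the antipode identity at x.\<close>
  have S_m: "?S \<cdot> \<kappa> = \<rho> H \<cdot> (\<one> H \<otimes> e)"
  proof -
    have "?S \<cdot> \<kappa> = (\<nu> \<cdot> (m \<otimes> \<one> B')) \<cdot> ((\<one> H \<otimes> \<one> B \<otimes> S) \<cdot> (inv_arr C (\<alpha> H B B) \<cdot> (\<one> H \<otimes> d)))"
      by (simp add: \<kappa>_def coext_def)
    also have "(\<one> H \<otimes> \<one> B \<otimes> S) \<cdot> (inv_arr C (\<alpha> H B B) \<cdot> (\<one> H \<otimes> d))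
        = inv_arr C (\<alpha> H B B') \<cdot> (\<one> H \<otimes> ((\<one> B \<otimes> S) \<cdot> d))"
      by (simp add: push)
    also have "\<nu> \<cdot> (m \<otimes> \<one> B') = \<mu> x x x \<cdot> ((\<one> H \<otimes> \<nu>) \<cdot> \<alpha> H B B')"
      using mult_assoc[of x x y x] by (simp add: defs)
    finally have "?S \<cdot> \<kappa> = \<mu> x x x \<cdot> (\<one> H \<otimes> (\<nu> \<cdot> ((\<one> B \<otimes> S) \<cdot> d)))"
      using defs by simp
    then show ?thesis
      unfolding antipode_right using pre_cmp[OF mult_unit_right[of x x], of "\<one> H \<otimes> e"] defs(1) by simp
  qed
  \<comment> \<open>The composite is again an extension, and by \<open>m_S\<close> the map being
    extended is the coKleisli identity.\<close>
  have split: "\<kappa> \<cdot> coext B B d ?S = \<one> (B \<odot> B)"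
    using coext_coext[OF B, of B ?S m] by (simp add: \<kappa>_def m_S coext_counit[OF B])
  have \<tau>_\<kappa>: "\<tau> \<cdot> \<kappa> = \<theta> \<cdot> (\<rho> H \<cdot> (\<one> H \<otimes> e))"
    using S_m by (simp add: \<tau>_def)
  have "(\<lambda>\<lambda> B \<cdot> coext B B d \<tau>) \<cdot> \<kappa> = \<lambda>\<lambda> B \<cdot> coext H B d (\<tau> \<cdot> \<kappa>)"
    using coext_coext[OF B, of H m \<tau>] by (simp add: \<kappa>_def coext_simps)
  also have "\<dots> = \<lambda>\<lambda> B \<cdot> (\<theta> \<otimes> \<one> B)"
    unfolding \<tau>_\<kappa> using coext_cmp_left[of H B d "\<rho> H \<cdot> (\<one> H \<otimes> e)" \<theta>] coext_counit[OF B, of H] by simp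
  finally have q: "(\<lambda>\<lambda> B \<cdot> coext B B d \<tau>) \<cdot> \<kappa> = \<lambda>\<lambda> B \<cdot> (\<theta> \<otimes> \<one> B)" .
  let ?M = "middle_exchange C H H B B" and ?N = "middle_exchange C H \<K> B \<K>"
  have m_hom: "comonoid_hom C (H \<odot> B) (tensor_comult C H (\<delta> x x) B d) (tensor_counit C (\<epsilon> x x) e) B d e m"
    using mult_comonoid_hom[of x x y] by (simp add: defs)
  have H: "comonoid C H (\<delta> x x) (\<epsilon> x x)"
    by (simp add: defs hom_comonoid)
  \<comment> \<open>The other side of the invariance on \<open>h \<otimes> b\<close>:
    \<open>h\<^sub>1 b\<^sub>1 \<tau>(h\<^sub>2 b\<^sub>2 \<otimes> b\<^sub>3) = h\<^sub>1 b\<^sub>1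
    \<theta>(h\<^sub>2) \<epsilon>(b\<^sub>2)\<close>.\<close>
  have "(\<rho> B \<cdot> ((\<one> B \<otimes> \<tau>) \<cdot> (\<alpha> B B B \<cdot> (d \<otimes> \<one> B)))) \<cdot> \<kappa> = \<rho> B \<cdot> ((\<one> B \<otimes> \<tau>) \<cdot> (\<alpha> B B B \<cdot> ((d \<otimes> \<one> B) \<cdot> coext H B d m)))"
    by (simp add: \<kappa>_def coext_simps)
  also have "\<dots> = \<rho> B \<cdot> ((m \<otimes> (\<tau> \<cdot> \<kappa>)) \<cdot> (?M \<cdot> (\<delta> x x \<otimes> d)))"
    unfolding comonoid_hom_coext[OF H B m_hom] by (simp add: \<kappa>_def[symmetric])
  also have "\<tau> \<cdot> \<kappa> = \<lambda>\<lambda> \<K> \<cdot> (\<theta> \<otimes> e)"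
  proof -
    have "\<tau> \<cdot> \<kappa> = \<rho> \<K> \<cdot> ((\<theta> \<otimes> \<one> \<K>) \<cdot> (\<one> H \<otimes> e))"
      unfolding \<tau>_\<kappa> by (simp add: run_push del: ten_merge)
    then show ?thesis
      by (simp add: lun_unt)
  qed
  also have "(m \<otimes> (\<lambda>\<lambda> \<K> \<cdot> (\<theta> \<otimes> e))) \<cdot> (?M \<cdot> (\<delta> x x \<otimes> d))
      = (m \<otimes> \<lambda>\<lambda> \<K>) \<cdot> ((\<one> H \<otimes> \<one> B \<otimes> (\<theta> \<otimes> e)) \<cdot> ?M \<cdot> (\<delta> x x \<otimes> d))"
    by simp
  \<comment> \<open>Naturality applies \<theta> and e before the exchange, which then only moves a
    unit object past B.\<close>
  also have "(\<one> H \<otimes> \<one> B \<otimes> (\<theta> \<otimes> e)) \<cdot> ?M = ?N \<cdot> (\<one> H \<otimes> \<theta> \<otimes> (\<one> B \<otimes> e))"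
    by (simp add: middle_exchange_nat)
  also have "(m \<otimes> \<lambda>\<lambda> \<K>) \<cdot> (?N \<cdot> (\<one> H \<otimes> \<theta> \<otimes> (\<one> B \<otimes> e)) \<cdot> (\<delta> x x \<otimes> d))
     = (m \<otimes> \<one> \<K>) \<cdot> (((\<one> (H \<odot> B) \<otimes> \<lambda>\<lambda> \<K>) \<cdot> ?N) \<cdot> (((\<one> H \<otimes> \<theta>) \<cdot> \<delta> x x) \<otimes> ((\<one> B \<otimes> e) \<cdot> d)))"
    by simp
  also have "(\<one> (H \<odot> B) \<otimes> \<lambda>\<lambda> \<K>) \<cdot> ?N = inv_arr C (\<alpha> H B \<K>) \<cdot> (\<rho> H \<otimes> \<one> (B \<odot> \<K>))"
    by (rule middle_exchange_unt) simp_all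
  also have "\<rho> B \<cdot> ((m \<otimes> \<one> \<K>) \<cdot> ((inv_arr C (\<alpha> H B \<K>) \<cdot> (\<rho> H \<otimes> \<one> (B \<odot> \<K>))) \<cdot> (((\<one> H \<otimes> \<theta>) \<cdot> \<delta> x x) \<otimes> ((\<one> B \<otimes> e) \<cdot> d))))
     = m \<cdot> ((\<rho> (H \<odot> B) \<cdot> inv_arr C (\<alpha> H B \<K>)) \<cdot> ((\<rho> H \<cdot> ((\<one> H \<otimes> \<theta>) \<cdot> \<delta> x x)) \<otimes> ((\<one> B \<otimes> e) \<cdot> d)))"
    by (simp add: run_push)
  also have "\<rho> (H \<odot> B) \<cdot> inv_arr C (\<alpha> H B \<K>) = \<one> H \<otimes> \<rho> B"
    unfolding run_asc[of H B, simplified, symmetric] by simp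
  \<comment> \<open>Colinearity of \<theta> replaces \<open>h\<^sub>1 \<theta>(h\<^sub>2)\<close> by
    \<open>\<theta>(h) 1\<close>, and the counit law of B removes e.\<close>
  also have "m \<cdot> ((\<one> H \<otimes> \<rho> B) \<cdot> ((\<rho> H \<cdot> ((\<one> H \<otimes> \<theta>) \<cdot> \<delta> x x)) \<otimes> ((\<one> B \<otimes> e) \<cdot> d)))
      = (m \<cdot> (\<eta> x \<otimes> \<one> B)) \<cdot> (\<theta> \<otimes> \<one> B)"
    unfolding invariant using comonoid_laws(3)[OF B] by simp
  also have "m \<cdot> (\<eta> x \<otimes> \<one> B) = \<lambda>\<lambda> B"
    using mult_unit_left[of x y] by (simp add: defs)
  finally have "(\<rho> B \<cdot> ((\<one> B \<otimes> \<tau>) \<cdot> (\<alpha> B B B \<cdot> (d \<otimes> \<one> B)))) \<cdot> \<kappa> = (\<lambda>\<lambda> B \<cdot> coext B B d \<tau>) \<cdot> \<kappa>"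
    using q by simp
  \<comment> \<open>Both sides agree after \<kappa>; its section from \<open>split\<close> cancels
    it.\<close>
  then have "((\<rho> B \<cdot> ((\<one> B \<otimes> \<tau>) \<cdot> (\<alpha> B B B \<cdot> (d \<otimes> \<one> B)))) \<cdot> \<kappa>) \<cdot> coext B B d ?S
      = ((\<lambda>\<lambda> B \<cdot> coext B B d \<tau>) \<cdot> \<kappa>) \<cdot> coext B B d ?S"
    by simp
  then have "\<rho> B \<cdot> ((\<one> B \<otimes> \<tau>) \<cdot> (\<alpha> B B B \<cdot> (d \<otimes> \<one> B))) = \<lambda>\<lambda> B \<cdot> coext B B d \<tau>"
    by (simp add: coext_simps split)
  \<comment> \<open>In elements: \<open>\<theta>(b\<^sub>1 \<sigma>(b\<^sub>2)) = \<theta>(1)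
    \<epsilon>(b)\<close>.\<close>
  moreover have "\<tau> \<cdot> d = (\<theta> \<cdot> \<eta> x) \<cdot> e"
    using antipode_right by (simp add: \<tau>_def)
  then have "\<tau> \<cdot> d = e"
    by (simp add: \<theta>(3))
  ultimately show ?thesis
    using coseparableI[OF B, of \<tau>] by (simp add: defs(2,6,7))
qed

end

section \<open>The reversed tensor product\<close>

text \<open>The associator must be inverted and the unit constraints interchanged, but the braiding
  already has the right type after a swap of its arguments. Keeping it uninverted is what makes
  \<open>middle_exchange_reverse\<close> an equality.\<close>

definition reverse :: "('o, 'm, 'z) brcat_scheme \<Rightarrow> ('o, 'm, 'z) brcat_scheme"
  where "reverse C = C\<lparr>TenO := \<lambda>a b. b \<odot>\<^bsub>C\<^esub> a, Ten := \<lambda>f g. g \<otimes>\<^bsub>C\<^esub> f,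
    Asc := \<lambda>a b c. inv_arr C (\<alpha>\<^bsub>C\<^esub> c b a), Lun := Run C, Run := Lun C, Brd := \<lambda>a b. \<c>\<^bsub>C\<^esub> b a\<rparr>"

lemma reverse_simps [simp]:
  "Obj (reverse C) = Obj C" "Arr (reverse C) = Arr C" "Src (reverse C) = Src C" "Tgt (reverse C) = Tgt C"
  "Idn (reverse C) = Idn C" "Cmp (reverse C) = Cmp C" "Unt (reverse C) = Unt C"
  "a \<odot>\<^bsub>reverse C\<^esub> b = b \<odot>\<^bsub>C\<^esub> a" "f \<otimes>\<^bsub>reverse C\<^esub> g = g \<otimes>\<^bsub>C\<^esub> f"
  "\<alpha>\<^bsub>reverse C\<^esub> a b c = inv_arr C (\<alpha>\<^bsub>C\<^esub> c b a)" "Lun (reverse C) = Run C" "Run (reverse C) = Lun C"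
  "\<c>\<^bsub>reverse C\<^esub> a b = \<c>\<^bsub>C\<^esub> b a"
  by (simp_all add: reverse_def)

lemma hom_reverse [simp]: "hom (reverse C) = hom C"
  by (simp add: hom_def fun_eq_iff)

lemma inverse_arrows_reverse [simp]: "inverse_arrows (reverse C) = inverse_arrows C"
  by (simp add: inverse_arrows_def fun_eq_iff)

lemma iso_reverse [simp]: "iso (reverse C) = iso C"
  by (simp add: iso_def fun_eq_iff)

lemma inv_arr_reverse [simp]: "inv_arr (reverse C) = inv_arr C"
  by (simp add: inv_arr_def fun_eq_iff)

context braided_monoidal_category
begin

text \<open>Reversal interchanges the two hexagons and turns the triangle and the pentagon into
  their forms with inverse associators.\<close>

lemma braided_monoidal_reverse: "braided_monoidal_category (reverse C)"
proof unfold_locales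
  fix a b assume "a \<in> Obj (reverse C)" "b \<in> Obj (reverse C)"
  then have [simp]: "a \<in> Obj C" "b \<in> Obj C"
    by simp_all
  show "\<one>\<^bsub>reverse C\<^esub> a \<otimes>\<^bsub>reverse C\<^esub> \<lambda>\<lambda>\<^bsub>reverse C\<^esub> b \<cdot>\<^bsub>reverse C\<^esub> \<alpha>\<^bsub>reverse C\<^esub> a \<K>\<^bsub>reverse C\<^esub> b
      = \<rho>\<^bsub>reverse C\<^esub> a \<otimes>\<^bsub>reverse C\<^esub> \<one>\<^bsub>reverse C\<^esub> b"
    by (simp add: triangle_inv)
next
  fix a b c d assume "a \<in> Obj (reverse C)" "b \<in> Obj (reverse C)" "c \<in> Obj (reverse C)" "d \<in> Obj (reverse C)"
  then have [simp]: "a \<in> Obj C" "b \<in> Obj C" "c \<in> Obj C" "d \<in> Obj C"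
    by simp_all
  show "\<one>\<^bsub>reverse C\<^esub> a \<otimes>\<^bsub>reverse C\<^esub> \<alpha>\<^bsub>reverse C\<^esub> b c d \<cdot>\<^bsub>reverse C\<^esub> \<alpha>\<^bsub>reverse C\<^esub> a (b \<odot>\<^bsub>reverse C\<^esub> c) d
      \<cdot>\<^bsub>reverse C\<^esub> \<alpha>\<^bsub>reverse C\<^esub> a b c \<otimes>\<^bsub>reverse C\<^esub> \<one>\<^bsub>reverse C\<^esub> d
    = \<alpha>\<^bsub>reverse C\<^esub> a b (c \<odot>\<^bsub>reverse C\<^esub> d) \<cdot>\<^bsub>reverse C\<^esub> \<alpha>\<^bsub>reverse C\<^esub> (a \<odot>\<^bsub>reverse C\<^esub> b) c d"
    using pre_cmp[OF pentagon_inv[of d c b a, symmetric], of "\<one> d \<otimes> inv_arr C (\<alpha> c b a)"] by simp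
next
  fix a b c assume "a \<in> Obj (reverse C)" "b \<in> Obj (reverse C)" "c \<in> Obj (reverse C)"
  then have [simp]: "a \<in> Obj C" "b \<in> Obj C" "c \<in> Obj C"
    by simp_all
  show "\<alpha>\<^bsub>reverse C\<^esub> b c a \<cdot>\<^bsub>reverse C\<^esub> \<c>\<^bsub>reverse C\<^esub> a (b \<odot>\<^bsub>reverse C\<^esub> c) \<cdot>\<^bsub>reverse C\<^esub> \<alpha>\<^bsub>reverse C\<^esub> a b c
    = \<one>\<^bsub>reverse C\<^esub> b \<otimes>\<^bsub>reverse C\<^esub> \<c>\<^bsub>reverse C\<^esub> a c \<cdot>\<^bsub>reverse C\<^esub> \<alpha>\<^bsub>reverse C\<^esub> b a c
      \<cdot>\<^bsub>reverse C\<^esub> \<c>\<^bsub>reverse C\<^esub> a b \<otimes>\<^bsub>reverse C\<^esub> \<one>\<^bsub>reverse C\<^esub> c"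
    using hexagon2[of c b a] by (simp del: cmp_assoc_simp)
  show "inv_arr (reverse C) (\<alpha>\<^bsub>reverse C\<^esub> c a b) \<cdot>\<^bsub>reverse C\<^esub> \<c>\<^bsub>reverse C\<^esub> (a \<odot>\<^bsub>reverse C\<^esub> b) c
      \<cdot>\<^bsub>reverse C\<^esub> inv_arr (reverse C) (\<alpha>\<^bsub>reverse C\<^esub> a b c)
    = \<c>\<^bsub>reverse C\<^esub> a c \<otimes>\<^bsub>reverse C\<^esub> \<one>\<^bsub>reverse C\<^esub> b \<cdot>\<^bsub>reverse C\<^esub> inv_arr (reverse C) (\<alpha>\<^bsub>reverse C\<^esub> a c b)
      \<cdot>\<^bsub>reverse C\<^esub> \<one>\<^bsub>reverse C\<^esub> a \<otimes>\<^bsub>reverse C\<^esub> \<c>\<^bsub>reverse C\<^esub> b c"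
    using hexagon1[of c b a] by (simp add: inv_arr_inv_arr del: cmp_assoc_simp)
qed (auto simp: hom_iff iso_inv_arr push lun_push run_push brd_push)

text \<open>The two definitions reach the middle factors through different bracketings, one grouping
  to the right and one to the left. A pentagon on the way in and another on the way out compare the
  two paths.\<close>

lemma middle_exchange_reverse:
  assumes [simp]: "a \<in> Obj C" "b \<in> Obj C" "c \<in> Obj C" "d \<in> Obj C"
  shows "middle_exchange (reverse C) d c b a = middle_exchange C a b c d"
proof -
  have in_pentagon: "(\<one> a \<otimes> inv_arr C (\<alpha> b c d)) \<cdot> \<alpha> a b (c \<odot> d)
      = \<alpha> a (b \<odot> c) d \<cdot> ((\<alpha> a b c \<otimes> \<one> d) \<cdot> inv_arr C (\<alpha> (a \<odot> b) c d))"
  proof (rule iso_cancel_left[rotated -1])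
    show "(\<one> a \<otimes> \<alpha> b c d) \<cdot> ((\<one> a \<otimes> inv_arr C (\<alpha> b c d)) \<cdot> \<alpha> a b (c \<odot> d))
        = (\<one> a \<otimes> \<alpha> b c d) \<cdot> (\<alpha> a (b \<odot> c) d \<cdot> ((\<alpha> a b c \<otimes> \<one> d) \<cdot> inv_arr C (\<alpha> (a \<odot> b) c d)))"
      using pre_cmp[OF pentagon'[of a b c d], of "inv_arr C (\<alpha> (a \<odot> b) c d)"] by simp
  qed (simp_all add: iso_ten)
  have out_pentagon: "inv_arr C (\<alpha> a c (b \<odot> d)) \<cdot> ((\<one> a \<otimes> \<alpha> c b d) \<cdot> \<alpha> a (c \<odot> b) d)
      = \<alpha> (a \<odot> c) b d \<cdot> (inv_arr C (\<alpha> a c b) \<otimes> \<one> d)"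
  proof (rule iso_cancel_right[rotated -1])
    show "(inv_arr C (\<alpha> a c (b \<odot> d)) \<cdot> ((\<one> a \<otimes> \<alpha> c b d) \<cdot> \<alpha> a (c \<odot> b) d)) \<cdot> (\<alpha> a c b \<otimes> \<one> d)
        = (\<alpha> (a \<odot> c) b d \<cdot> (inv_arr C (\<alpha> a c b) \<otimes> \<one> d)) \<cdot> (\<alpha> a c b \<otimes> \<one> d)"
      by (simp add: pentagon')
  qed (simp_all add: iso_ten)
  have "middle_exchange C a b c d
     = inv_arr C (\<alpha> a c (b \<odot> d)) \<cdot> ((\<one> a \<otimes> \<alpha> c b d) \<cdot> ((\<one> a \<otimes> (\<c> b c \<otimes> \<one> d)) \<cdot> ((\<one> a \<otimes> inv_arr C (\<alpha> b c d)) \<cdot> \<alpha> a b (c \<odot> d))))"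
    by (simp add: middle_exchange_def)
  also have "\<dots> = (inv_arr C (\<alpha> a c (b \<odot> d)) \<cdot> ((\<one> a \<otimes> \<alpha> c b d) \<cdot> \<alpha> a (c \<odot> b) d))
      \<cdot> ((\<one> a \<otimes> \<c> b c \<otimes> \<one> d) \<cdot> ((\<alpha> a b c \<otimes> \<one> d) \<cdot> inv_arr C (\<alpha> (a \<odot> b) c d)))"
    unfolding in_pentagon using asc_push(2)[of "\<one> a" "\<c> b c" "\<one> d" a "c \<odot> b" d "(\<alpha> a b c \<otimes> \<one> d) \<cdot> inv_arr C (\<alpha> (a \<odot> b) c d)"]
    by (simp del: ten_merge)
  also have "\<dots> = middle_exchange (reverse C) d c b a"
    unfolding out_pentagon by (simp add: middle_exchange_def inv_arr_inv_arr)
  finally show ?thesis ..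
qed

lemma comonoid_reverse [simp]: "comonoid (reverse C) A d e \<longleftrightarrow> comonoid C A d e"
proof -
  have "inv_arr C (\<alpha> A A A) \<cdot> ((\<one> A \<otimes> d) \<cdot> d) = (d \<otimes> \<one> A) \<cdot> d
      \<longleftrightarrow> \<alpha> A A A \<cdot> ((d \<otimes> \<one> A) \<cdot> d) = (\<one> A \<otimes> d) \<cdot> d"
    if [simp]: "A \<in> Obj C" "d \<in> Arr C" "Src C d = A" "Tgt C d = A \<odot> A"
  proof
    assume "inv_arr C (\<alpha> A A A) \<cdot> ((\<one> A \<otimes> d) \<cdot> d) = (d \<otimes> \<one> A) \<cdot> d"
    from this[symmetric] show "\<alpha> A A A \<cdot> ((d \<otimes> \<one> A) \<cdot> d) = (\<one> A \<otimes> d) \<cdot> d"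
      by simp
  next
    assume "\<alpha> A A A \<cdot> ((d \<otimes> \<one> A) \<cdot> d) = (\<one> A \<otimes> d) \<cdot> d"
    from this[symmetric] show "inv_arr C (\<alpha> A A A) \<cdot> ((\<one> A \<otimes> d) \<cdot> d) = (d \<otimes> \<one> A) \<cdot> d"
      by simp
  qed
  then show ?thesis
    by (auto simp: comonoid_def hom_iff)
qed

text \<open>The same retraction serves on both sides, since reversal interchanges the left and right
  coactions and hence the two colinearity conditions.\<close>

lemma coseparable_reverse [simp]: "coseparable (reverse C) A d e \<longleftrightarrow> coseparable C A d e"
proof (cases "comonoid C A d e")
  case True
  then show ?thesis
    using comonoid_simps[OF True]
    by (auto simp: coseparable_def bicomodule_hom_def inv_arr_inv_arr)
qed (simp add: coseparable_def)

end

text \<open>The reversed product of \<open>a y x\<close> and \<open>a z y\<close> is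
  \<open>a z y \<odot> a y x\<close>, the source of \<open>\<mu> z y x\<close>; this is why homs are
  read backwards. The comultiplications stay as they are, and \<open>lun_unt\<close> reconciles the
  counits and the unit comonoid.\<close>

lemma (in hopf_category) hopf_reverse:
  "hopf_category (reverse C) X (\<lambda>x y. a y x) (\<lambda>x y. \<delta> y x) (\<lambda>x y. \<epsilon> y x) (\<lambda>x y z. \<mu> z y x) \<eta>"
proof -
  interpret rev: braided_monoidal_category "reverse C"
    by (rule braided_monoidal_reverse)
  show ?thesis
  proof unfold_locales
    fix x y assume [simp]: "x \<in> X" "y \<in> X"
    show "comonoid (reverse C) (a y x) (\<delta> y x) (\<epsilon> y x)"
      by (simp add: hom_comonoid)
    show "\<mu> y x x \<cdot>\<^bsub>reverse C\<^esub> (\<eta> x \<otimes>\<^bsub>reverse C\<^esub> \<one>\<^bsub>reverse C\<^esub> (a y x)) = \<lambda>\<lambda>\<^bsub>reverse C\<^esub> (a y x)"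
      by (simp add: mult_unit_right)
    show "\<mu> y y x \<cdot>\<^bsub>reverse C\<^esub> (\<one>\<^bsub>reverse C\<^esub> (a y x) \<otimes>\<^bsub>reverse C\<^esub> \<eta> y) = \<rho>\<^bsub>reverse C\<^esub> (a y x)"
      by (simp add: mult_unit_left)
    fix z assume [simp]: "z \<in> X"
    show "comonoid_hom (reverse C) (a y x \<odot>\<^bsub>reverse C\<^esub> a z y)
        (tensor_comult (reverse C) (a y x) (\<delta> y x) (a z y) (\<delta> z y))
        (tensor_counit (reverse C) (\<epsilon> y x) (\<epsilon> z y)) (a z x) (\<delta> z x) (\<epsilon> z x) (\<mu> z y x)"
      using mult_comonoid_hom[of z y x]
      by (simp add: comonoid_hom_def tensor_comult_def tensor_counit_def middle_exchange_reverse lun_unt)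
    fix w assume [simp]: "w \<in> X"
    show "\<mu> w z x \<cdot>\<^bsub>reverse C\<^esub> (\<mu> z y x \<otimes>\<^bsub>reverse C\<^esub> \<one>\<^bsub>reverse C\<^esub> (a w z))
        = \<mu> w y x \<cdot>\<^bsub>reverse C\<^esub> (\<one>\<^bsub>reverse C\<^esub> (a y x) \<otimes>\<^bsub>reverse C\<^esub> \<mu> w z y)
            \<cdot>\<^bsub>reverse C\<^esub> \<alpha>\<^bsub>reverse C\<^esub> (a y x) (a z y) (a w z)"
      using mult_assoc[of w z y x] by simp
  next
    fix x assume [simp]: "x \<in> X"
    show "comonoid_hom (reverse C) \<K>\<^bsub>reverse C\<^esub> (unit_comult (reverse C)) (unit_counit (reverse C))
        (a x x) (\<delta> x x) (\<epsilon> x x) (\<eta> x)"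
      using unit_comonoid_hom[of x] by (simp add: comonoid_hom_def unit_comult_def unit_counit_def lun_unt)
  next
    obtain \<sigma> where "\<forall>x\<in>X. \<forall>y\<in>X. \<sigma> x y \<in> hom C (a x y) (a y x) \<and>
      \<mu> x y x \<cdot> (\<one> (a x y) \<otimes> \<sigma> x y) \<cdot> \<delta> x y = \<eta> x \<cdot> \<epsilon> x y \<and>
      \<mu> y x y \<cdot> (\<sigma> x y \<otimes> \<one> (a x y)) \<cdot> \<delta> x y = \<eta> y \<cdot> \<epsilon> x y"
      using antipode by blast
    then show "\<exists>\<sigma>. \<forall>x\<in>X. \<forall>y\<in>X. \<sigma> x y \<in> hom (reverse C) (a y x) (a x y) \<and>
      \<mu> x y x \<cdot>\<^bsub>reverse C\<^esub> (\<one>\<^bsub>reverse C\<^esub> (a y x) \<otimes>\<^bsub>reverse C\<^esub> \<sigma> x y) \<cdot>\<^bsub>reverse C\<^esub> \<delta> y x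
        = \<eta> x \<cdot>\<^bsub>reverse C\<^esub> \<epsilon> y x \<and>
      \<mu> y x y \<cdot>\<^bsub>reverse C\<^esub> (\<sigma> x y \<otimes>\<^bsub>reverse C\<^esub> \<one>\<^bsub>reverse C\<^esub> (a y x)) \<cdot>\<^bsub>reverse C\<^esub> \<delta> y x
        = \<eta> y \<cdot>\<^bsub>reverse C\<^esub> \<epsilon> y x"
      \<comment> \<open>The component for x, y has to start at \<open>a y x\<close>, so the indices
        of \<sigma> are swapped, which also interchanges its two identities.\<close>
      by (intro exI[of _ "\<lambda>x y. \<sigma> y x"]) simp
  qed
qed

section \<open>The equivalence of (i'), (ii) and (iii)\<close>

context hopf_category
begin

text \<open>Forwards, the diagonal case is combined with the group-like \<open>\<eta> x\<close>;
  backwards, the retraction at x serves every hom object with first index x.\<close>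

lemma coseparable_iff_left_retraction:
  "(\<forall>x\<in>X. \<forall>y\<in>X. coseparable C (a x y) (\<delta> x y) (\<epsilon> x y)) \<longleftrightarrow>
   (\<forall>x\<in>X. \<exists>\<theta>\<in>hom C (a x x) \<K>.
      \<rho> (a x x) \<cdot> (\<one> (a x x) \<otimes> \<theta>) \<cdot> \<delta> x x = \<eta> x \<cdot> \<theta> \<and> \<theta> \<cdot> \<eta> x = \<one> \<K>)"
  using coseparable_comodule_retraction unit_comonoid_hom comodule_retraction_coseparable by metis

text \<open>The diagonal comonoids and units are unchanged by reversal, their left retractions there
  are the right retractions here, and (i') is symmetric in x and y.\<close>

lemma coseparable_iff_right_retraction:
  "(\<forall>x\<in>X. \<forall>y\<in>X. coseparable C (a x y) (\<delta> x y) (\<epsilon> x y)) \<longleftrightarrow>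
   (\<forall>x\<in>X. \<exists>\<theta>\<in>hom C (a x x) \<K>.
      \<lambda>\<lambda> (a x x) \<cdot> (\<theta> \<otimes> \<one> (a x x)) \<cdot> \<delta> x x = \<eta> x \<cdot> \<theta> \<and> \<theta> \<cdot> \<eta> x = \<one> \<K>)"
  using hopf_category.coseparable_iff_left_retraction[OF hopf_reverse] by auto

end

section \<open>Comonoids of spans\<close>

lemma span_category_simps [simp]:
  "Obj (span_category C X) = span_objects C X"
  "Arr (span_category C X) = span_arrows C X"
  "Src (span_category C X) = SSrc"
  "Tgt (span_category C X) = STgt"
  "\<one>\<^bsub>span_category C X\<^esub> A = make_arrow A A (\<lambda>h. h) (\<lambda>h. \<one>\<^bsub>C\<^esub> (Label A h))"
  "G \<cdot>\<^bsub>span_category C X\<^esub> F = make_arrow (SSrc F) (STgt G)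
     (\<lambda>h. SMap G (SMap F h)) (\<lambda>h. SFam G (SMap F h) \<cdot>\<^bsub>C\<^esub> SFam F h)"
  "\<K>\<^bsub>span_category C X\<^esub> = square_span X (\<lambda>x y. \<K>\<^bsub>C\<^esub>)"
  "A \<odot>\<^bsub>span_category C X\<^esub> B = span_prod C A B"
  "G \<otimes>\<^bsub>span_category C X\<^esub> F = make_arrow (span_prod C (SSrc G) (SSrc F)) (span_prod C (STgt G) (STgt F))
     (\<lambda>p. Node (SMap G (nleft p)) (SMap F (nright p))) (\<lambda>p. SFam G (nleft p) \<otimes>\<^bsub>C\<^esub> SFam F (nright p))"
  "\<alpha>\<^bsub>span_category C X\<^esub> D B A = make_arrow (span_prod C (span_prod C D B) A) (span_prod C D (span_prod C B A))
     (\<lambda>p. Node (nleft (nleft p)) (Node (nright (nleft p)) (nright p)))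
     (\<lambda>p. \<alpha>\<^bsub>C\<^esub> (Label D (nleft (nleft p))) (Label B (nright (nleft p))) (Label A (nright p)))"
  "\<lambda>\<lambda>\<^bsub>span_category C X\<^esub> A = make_arrow (span_prod C (square_span X (\<lambda>x y. \<K>\<^bsub>C\<^esub>)) A) A
     nright (\<lambda>p. \<lambda>\<lambda>\<^bsub>C\<^esub> (Label A (nright p)))"
  "\<rho>\<^bsub>span_category C X\<^esub> A = make_arrow (span_prod C A (square_span X (\<lambda>x y. \<K>\<^bsub>C\<^esub>))) A
     nleft (\<lambda>p. \<rho>\<^bsub>C\<^esub> (Label A (nleft p)))"
  by (simp_all add: span_category_def)

lemma make_arrow_simps [simp]:
  "SSrc (make_arrow A B f \<phi>) = A" "STgt (make_arrow A B f \<phi>) = B"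
  "h \<in> Apex A \<Longrightarrow> SMap (make_arrow A B f \<phi>) h = f h"
  "h \<in> Apex A \<Longrightarrow> SFam (make_arrow A B f \<phi>) h = \<phi> h"
  by (simp_all add: make_arrow_def)

lemma make_arrow_cong:
  "(\<And>h. h \<in> Apex A \<Longrightarrow> f h = g h \<and> \<phi> h = \<psi> h) \<Longrightarrow> make_arrow A B f \<phi> = make_arrow A B g \<psi>"
  by (auto simp: make_arrow_def restrict_def)

lemma make_arrow_in_span_arrows:
  assumes "A \<in> span_objects C X" "B \<in> span_objects C X"
    and "\<And>h. h \<in> Apex A \<Longrightarrow> f h \<in> Apex B \<and> LeftLeg B (f h) = LeftLeg A h \<and> RightLeg B (f h) = RightLeg A h"
    and "\<And>h. h \<in> Apex A \<Longrightarrow> \<phi> h \<in> hom C (Label A h) (Label B (f h))"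
  shows "make_arrow A B f \<phi> \<in> span_arrows C X"
  using assms by (auto simp: span_arrows_def make_arrow_def)

lemma span_arrowsD:
  assumes "F \<in> span_arrows C X"
  shows "SSrc F \<in> span_objects C X" "STgt F \<in> span_objects C X"
    "h \<in> Apex (SSrc F) \<Longrightarrow> SMap F h \<in> Apex (STgt F)"
    "h \<in> Apex (SSrc F) \<Longrightarrow> LeftLeg (STgt F) (SMap F h) = LeftLeg (SSrc F) h"
    "h \<in> Apex (SSrc F) \<Longrightarrow> RightLeg (STgt F) (SMap F h) = RightLeg (SSrc F) h"
    "h \<in> Apex (SSrc F) \<Longrightarrow> SFam F h \<in> hom C (Label (SSrc F) h) (Label (STgt F) (SMap F h))"
  using assms by (auto simp: span_arrows_def)

text \<open>Arrows store functions that are extensional on the source apex; restricting them again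
  changes nothing, so the identity laws hold as equations of records.\<close>

lemma make_arrow_eta:
  assumes "F \<in> span_arrows C X"
  shows "make_arrow (SSrc F) (STgt F) (SMap F) (SFam F) = F"
  using assms by (auto simp: span_arrows_def make_arrow_def PiE_restrict)

lemma span_objectsD:
  assumes "A \<in> span_objects C X" "h \<in> Apex A"
  shows "LeftLeg A h \<in> X" "RightLeg A h \<in> X" "Label A h \<in> Obj C"
  using assms by (auto simp: span_objects_def)

lemma Node_in_span_prod [simp]:
  "Node d h \<in> Apex (span_prod C B A) \<longleftrightarrow>
    d \<in> Apex B \<and> h \<in> Apex A \<and> LeftLeg B d = LeftLeg A h \<and> RightLeg B d = RightLeg A h"
  by (auto simp: span_prod_def make_span_def)

lemma span_prod_cases:
  assumes "p \<in> Apex (span_prod C B A)"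
  obtains d h where "p = Node d h" "d \<in> Apex B" "h \<in> Apex A" "LeftLeg B d = LeftLeg A h"
    "RightLeg B d = RightLeg A h"
  using assms by (auto simp: span_prod_def make_span_def)

lemma span_prod_simps [simp]:
  assumes "d \<in> Apex B" "h \<in> Apex A" "LeftLeg B d = LeftLeg A h" "RightLeg B d = RightLeg A h"
  shows "LeftLeg (span_prod C B A) (Node d h) = LeftLeg A h"
    "RightLeg (span_prod C B A) (Node d h) = RightLeg A h"
    "Label (span_prod C B A) (Node d h) = Label B d \<odot>\<^bsub>C\<^esub> Label A h"
  using assms by (auto simp: span_prod_def make_span_def)

lemma Base_in_square_span [simp]: "Base x y \<in> Apex (square_span X a) \<longleftrightarrow> x \<in> X \<and> y \<in> X"
  by (auto simp: square_span_def make_span_def)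

lemma square_span_cases:
  assumes "p \<in> Apex (square_span X a)"
  obtains x y where "p = Base x y" "x \<in> X" "y \<in> X"
  using assms by (auto simp: square_span_def make_span_def)

lemma square_span_simps [simp]:
  assumes "x \<in> X" "y \<in> X"
  shows "LeftLeg (square_span X a) (Base x y) = x" "RightLeg (square_span X a) (Base x y) = y"
    "Label (square_span X a) (Base x y) = a x y"
  using assms by (auto simp: square_span_def make_span_def)

lemma square_span_object:
  "(\<And>x y. x \<in> X \<Longrightarrow> y \<in> X \<Longrightarrow> a x y \<in> Obj C) \<Longrightarrow> square_span X a \<in> span_objects C X"
  by (auto simp: span_objects_def square_span_def make_span_def)

section \<open>Coseparability of spans, point by point\<close>

context monoidal_category
begin

lemma span_prod_object:
  assumes "B \<in> span_objects C X" "A \<in> span_objects C X"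
  shows "span_prod C B A \<in> span_objects C X"
proof -
  note [simp] = span_objectsD[OF assms(1)] span_objectsD[OF assms(2)]
  show ?thesis
    unfolding span_objects_def by (auto simp: span_prod_def make_span_def)
qed

text \<open>Its purpose is uniqueness of inverses: \<open>inv_arr\<close> is a definite description,
  and its value at the associator of spans is to be identified.\<close>

lemma category_span_category:
  fixes X :: "'x set"
  shows "category (span_category C X :: (('x, 's, 'o) span, ('x, 's, 'o, 'm) span_arrow) moncat)"
proof unfold_locales
  fix A :: "('x, 's, 'o) span"
  show "A \<in> Obj (span_category C X) \<Longrightarrow> \<one>\<^bsub>span_category C X\<^esub> A \<in> hom (span_category C X) A A"
    by (auto simp: hom_iff span_objectsD intro!: make_arrow_in_span_arrows)
next
  fix F G :: "('x, 's, 'o, 'm) span_arrow" and A B D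
  assume "F \<in> hom (span_category C X) A B" "G \<in> hom (span_category C X) B D"
  then show "G \<cdot>\<^bsub>span_category C X\<^esub> F \<in> hom (span_category C X) A D"
    using span_arrowsD[of F C X] span_arrowsD[of G C X]
    by (auto simp: hom_iff intro!: make_arrow_in_span_arrows)
next
  fix F :: "('x, 's, 'o, 'm) span_arrow" and A B
  assume F: "F \<in> hom (span_category C X) A B"
  then have F': "F \<in> span_arrows C X" "SSrc F = A" "STgt F = B"
    by (simp_all add: hom_iff)
  have "\<one>\<^bsub>span_category C X\<^esub> B \<cdot>\<^bsub>span_category C X\<^esub> F = make_arrow (SSrc F) (STgt F) (SMap F) (SFam F)"
    using F' span_arrowsD(3,6)[OF F'(1)] by (auto simp: hom_iff intro!: make_arrow_cong)
  then show "\<one>\<^bsub>span_category C X\<^esub> B \<cdot>\<^bsub>span_category C X\<^esub> F = F"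
    unfolding make_arrow_eta[OF F'(1)] .
  have "F \<cdot>\<^bsub>span_category C X\<^esub> \<one>\<^bsub>span_category C X\<^esub> A = make_arrow (SSrc F) (STgt F) (SMap F) (SFam F)"
    using F' span_arrowsD(3,6)[OF F'(1)] by (auto simp: hom_iff intro!: make_arrow_cong)
  then show "F \<cdot>\<^bsub>span_category C X\<^esub> \<one>\<^bsub>span_category C X\<^esub> A = F"
    unfolding make_arrow_eta[OF F'(1)] .
next
  fix F G H :: "('x, 's, 'o, 'm) span_arrow" and A B D E
  assume "F \<in> hom (span_category C X) A B" "G \<in> hom (span_category C X) B D" "H \<in> hom (span_category C X) D E"
  then show "H \<cdot>\<^bsub>span_category C X\<^esub> G \<cdot>\<^bsub>span_category C X\<^esub> F
      = H \<cdot>\<^bsub>span_category C X\<^esub> (G \<cdot>\<^bsub>span_category C X\<^esub> F)"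
    using span_arrowsD(3,6)[of F C X] span_arrowsD(3,6)[of G C X] span_arrowsD(3,6)[of H C X]
    by (auto simp: hom_iff intro!: make_arrow_cong)
qed (auto simp: span_arrowsD)

text \<open>Rebracketing is a bijection of the iterated fibre products, and over each of their
  points the associator of C is invertible.\<close>

lemma span_asc_inv:
  fixes X :: "'x set" and A :: "('x, 's, 'o) span"
  assumes "D \<in> span_objects C X" "B \<in> span_objects C X" "A \<in> span_objects C X"
  shows "inv_arr (span_category C X :: (('x, 's, 'o) span, ('x, 's, 'o, 'm) span_arrow) moncat)
      (\<alpha>\<^bsub>span_category C X\<^esub> D B A)
    = make_arrow (span_prod C D (span_prod C B A)) (span_prod C (span_prod C D B) A)
     (\<lambda>p. Node (Node (nleft p) (nleft (nright p))) (nright (nright p)))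
     (\<lambda>p. inv_arr C (\<alpha> (Label D (nleft p)) (Label B (nleft (nright p))) (Label A (nright (nright p)))))"
proof (rule category.inv_arr_eq[OF category_span_category], unfold inverse_arrows_def, intro conjI)
qed (use assms span_objectsD[OF assms(1)] span_objectsD[OF assms(2)] span_objectsD[OF assms(3)] in
    \<open>auto simp: hom_iff span_prod_object intro!: make_arrow_in_span_arrows make_arrow_cong elim!: span_prod_cases\<close>)

text \<open>The two legs together are injective on X^2, so an arrow from X^2 \<bullet> X^2 to X^2 is
  forced on apexes and amounts to one morphism of C for each pair (x, y). Colinearity and the
  retraction property are then conditions over each pair separately.\<close>

lemma span_coseparable_iff:
  fixes a :: "'x \<Rightarrow> 'x \<Rightarrow> 'o" and X :: "'x set"
  assumes comon: "\<And>x y. x \<in> X \<Longrightarrow> y \<in> X \<Longrightarrow> comonoid C (a x y) (\<delta> x y) (\<epsilon> x y)"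
  shows "coseparable (span_category C X :: (('x, 's, 'o) span, ('x, 's, 'o, 'm) span_arrow) moncat)
      (square_span X a) (span_comult C X a \<delta>) (span_counit C X a \<epsilon>)
    \<longleftrightarrow> (\<forall>x\<in>X. \<forall>y\<in>X. coseparable C (a x y) (\<delta> x y) (\<epsilon> x y))"
proof -
  let ?C = "span_category C X :: (('x, 's, 'o) span, ('x, 's, 'o, 'm) span_arrow) moncat"
  let ?S = "square_span X a :: ('x, 's, 'o) span"
  note [simp] = comonoid_simps[OF comon]
  have [simp]: "?S \<in> span_objects C X" "square_span X (\<lambda>x y. \<K>) \<in> span_objects C X"
    by (simp_all add: square_span_object)
  have comonoid: "comonoid ?C ?S (span_comult C X a \<delta>) (span_counit C X a \<epsilon>)"
    unfolding comonoid_def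
    using comonoid_laws[OF comon]
    by (auto simp: hom_iff span_comult_def span_counit_def span_prod_object
        intro!: make_arrow_in_span_arrows make_arrow_cong elim!: square_span_cases)
  show ?thesis
  proof (intro iffI ballI)
    fix x y
    assume cosep: "coseparable ?C ?S (span_comult C X a \<delta>) (span_counit C X a \<epsilon>)"
      and [simp]: "x \<in> X" "y \<in> X"
    obtain p where p: "bicomodule_hom ?C ?S (span_prod C ?S ?S)
        (\<alpha>\<^bsub>?C\<^esub> ?S ?S ?S \<cdot>\<^bsub>?C\<^esub> (span_comult C X a \<delta> \<otimes>\<^bsub>?C\<^esub> \<one>\<^bsub>?C\<^esub> ?S))
        (inv_arr ?C (\<alpha>\<^bsub>?C\<^esub> ?S ?S ?S) \<cdot>\<^bsub>?C\<^esub> (\<one>\<^bsub>?C\<^esub> ?S \<otimes>\<^bsub>?C\<^esub> span_comult C X a \<delta>))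
        ?S (span_comult C X a \<delta>) (span_comult C X a \<delta>) p"
      and pd: "p \<cdot>\<^bsub>?C\<^esub> span_comult C X a \<delta> = \<one>\<^bsub>?C\<^esub> ?S"
      using cosep by (auto simp only: coseparable_def span_category_simps)
    let ?b = "Base x y" let ?n = "Node ?b ?b" let ?q = "SFam p ?n"
    have src [simp]: "p \<in> span_arrows C X" "SSrc p = span_prod C ?S ?S" "STgt p = ?S"
      using p by (simp_all add: bicomodule_hom_def hom_iff)
    have [simp]: "SMap p ?n = ?b"
      using span_arrowsD(3-5)[OF src(1), of ?n] by (auto elim!: square_span_cases)
    have [simp]: "?q \<in> Arr C" "Src C ?q = a x y \<odot> a x y" "Tgt C ?q = a x y"
      using span_arrowsD(6)[OF src(1), of ?n] by (auto simp: hom_iff)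
    \<comment> \<open>Equations of arrows are read off at a single apex point: \<open>?b\<close> for
      the retraction, \<open>?n\<close> above it for colinearity.\<close>
    have "SFam (p \<cdot>\<^bsub>?C\<^esub> span_comult C X a \<delta>) ?b = SFam (\<one>\<^bsub>?C\<^esub> ?S) ?b"
      by (simp only: pd)
    then have "?q \<cdot> \<delta> x y = \<one> (a x y)"
      by (simp add: span_comult_def)
    moreover from p have "SFam (span_comult C X a \<delta> \<cdot>\<^bsub>?C\<^esub> p) ?n
        = SFam ((\<one>\<^bsub>?C\<^esub> ?S \<otimes>\<^bsub>?C\<^esub> p) \<cdot>\<^bsub>?C\<^esub> (\<alpha>\<^bsub>?C\<^esub> ?S ?S ?S \<cdot>\<^bsub>?C\<^esub> (span_comult C X a \<delta> \<otimes>\<^bsub>?C\<^esub> \<one>\<^bsub>?C\<^esub> ?S))) ?n"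
      unfolding bicomodule_hom_def by (elim conjE) (rule arg_cong[where f = "\<lambda>F. SFam F ?n"])
    then have "\<delta> x y \<cdot> ?q = (\<one> (a x y) \<otimes> ?q) \<cdot> (\<alpha> (a x y) (a x y) (a x y) \<cdot> (\<delta> x y \<otimes> \<one> (a x y)))"
      by (simp add: span_comult_def)
    moreover from p have "SFam (span_comult C X a \<delta> \<cdot>\<^bsub>?C\<^esub> p) ?n
        = SFam ((p \<otimes>\<^bsub>?C\<^esub> \<one>\<^bsub>?C\<^esub> ?S) \<cdot>\<^bsub>?C\<^esub> (inv_arr ?C (\<alpha>\<^bsub>?C\<^esub> ?S ?S ?S) \<cdot>\<^bsub>?C\<^esub> (\<one>\<^bsub>?C\<^esub> ?S \<otimes>\<^bsub>?C\<^esub> span_comult C X a \<delta>))) ?n"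
      unfolding bicomodule_hom_def by (elim conjE) (rule arg_cong[where f = "\<lambda>F. SFam F ?n"])
    then have "\<delta> x y \<cdot> ?q
        = (?q \<otimes> \<one> (a x y)) \<cdot> (inv_arr C (\<alpha> (a x y) (a x y) (a x y)) \<cdot> (\<one> (a x y) \<otimes> \<delta> x y))"
      \<comment> \<open>The rule left out would unfold the associator before
        \<open>span_asc_inv\<close> could recognise its inverse.\<close>
      by (simp add: span_comult_def span_asc_inv del: span_category_simps(10))
    ultimately show "coseparable C (a x y) (\<delta> x y) (\<epsilon> x y)"
      unfolding coseparable_def bicomodule_hom_def
      using comon by (intro conjI exI[of _ ?q]) (simp_all add: hom_iff)
  next
    assume "\<forall>x\<in>X. \<forall>y\<in>X. coseparable C (a x y) (\<delta> x y) (\<epsilon> x y)"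
    then have "\<forall>x\<in>X. \<forall>y\<in>X. \<exists>q. q \<in> Arr C \<and> Src C q = a x y \<odot> a x y \<and> Tgt C q = a x y \<and>
        \<delta> x y \<cdot> q = (\<one> (a x y) \<otimes> q) \<cdot> (\<alpha> (a x y) (a x y) (a x y) \<cdot> (\<delta> x y \<otimes> \<one> (a x y))) \<and>
        \<delta> x y \<cdot> q = (q \<otimes> \<one> (a x y)) \<cdot> (inv_arr C (\<alpha> (a x y) (a x y) (a x y)) \<cdot> (\<one> (a x y) \<otimes> \<delta> x y)) \<and>
        q \<cdot> \<delta> x y = \<one> (a x y)"
      unfolding coseparable_def bicomodule_hom_def hom_iff by blast
    then obtain q where q: "\<forall>x\<in>X. \<forall>y\<in>X. q x y \<in> Arr C \<and> Src C (q x y) = a x y \<odot> a x y \<and> Tgt C (q x y) = a x y \<and>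
        \<delta> x y \<cdot> q x y = (\<one> (a x y) \<otimes> q x y) \<cdot> (\<alpha> (a x y) (a x y) (a x y) \<cdot> (\<delta> x y \<otimes> \<one> (a x y))) \<and>
        \<delta> x y \<cdot> q x y = (q x y \<otimes> \<one> (a x y)) \<cdot> (inv_arr C (\<alpha> (a x y) (a x y) (a x y)) \<cdot> (\<one> (a x y) \<otimes> \<delta> x y)) \<and>
        q x y \<cdot> \<delta> x y = \<one> (a x y)"
      by metis
    \<comment> \<open>Points of the fibre product have the form \<open>Node b b\<close>, so
      \<open>nleft\<close> inverts the diagonal underlying the comultiplication.\<close>
    define p where "p = make_arrow (span_prod C ?S ?S) ?S nleft (\<lambda>n. q (bleft (nleft n)) (bright (nleft n)))"
    have q' [simp]: "q x y \<in> Arr C" "Src C (q x y) = a x y \<odot> a x y" "Tgt C (q x y) = a x y"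
      if "x \<in> X" "y \<in> X" for x y
      using q that by blast+
    have left: "\<delta> x y \<cdot> q x y = (\<one> (a x y) \<otimes> q x y) \<cdot> (\<alpha> (a x y) (a x y) (a x y) \<cdot> (\<delta> x y \<otimes> \<one> (a x y)))"
      and right: "\<delta> x y \<cdot> q x y = (q x y \<otimes> \<one> (a x y)) \<cdot> (inv_arr C (\<alpha> (a x y) (a x y) (a x y)) \<cdot> (\<one> (a x y) \<otimes> \<delta> x y))"
      and retr: "q x y \<cdot> \<delta> x y = \<one> (a x y)"
      if "x \<in> X" "y \<in> X" for x y
      using q that by blast+
    have hom: "p \<in> hom ?C (span_prod C ?S ?S) ?S"
      by (auto simp: p_def hom_iff span_prod_object intro!: make_arrow_in_span_arrows
          elim!: span_prod_cases square_span_cases)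
    have 1: "span_comult C X a \<delta> \<cdot>\<^bsub>?C\<^esub> p
      = (\<one>\<^bsub>?C\<^esub> ?S \<otimes>\<^bsub>?C\<^esub> p) \<cdot>\<^bsub>?C\<^esub> (\<alpha>\<^bsub>?C\<^esub> ?S ?S ?S \<cdot>\<^bsub>?C\<^esub> (span_comult C X a \<delta> \<otimes>\<^bsub>?C\<^esub> \<one>\<^bsub>?C\<^esub> ?S))"
      using left by (auto simp: p_def span_comult_def intro!: make_arrow_cong elim!: span_prod_cases square_span_cases)
    have 2: "span_comult C X a \<delta> \<cdot>\<^bsub>?C\<^esub> p
      = (p \<otimes>\<^bsub>?C\<^esub> \<one>\<^bsub>?C\<^esub> ?S) \<cdot>\<^bsub>?C\<^esub> (inv_arr ?C (\<alpha>\<^bsub>?C\<^esub> ?S ?S ?S) \<cdot>\<^bsub>?C\<^esub> (\<one>\<^bsub>?C\<^esub> ?S \<otimes>\<^bsub>?C\<^esub> span_comult C X a \<delta>))"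
      unfolding span_asc_inv[OF \<open>?S \<in> span_objects C X\<close> \<open>?S \<in> span_objects C X\<close> \<open>?S \<in> span_objects C X\<close>]
      using right by (auto simp: p_def span_comult_def intro!: make_arrow_cong elim!: span_prod_cases square_span_cases)
    have 3: "p \<cdot>\<^bsub>?C\<^esub> span_comult C X a \<delta> = \<one>\<^bsub>?C\<^esub> ?S"
      using retr by (auto simp: p_def span_comult_def intro!: make_arrow_cong elim!: square_span_cases)
    show "coseparable ?C ?S (span_comult C X a \<delta>) (span_counit C X a \<epsilon>)"
      unfolding coseparable_def bicomodule_hom_def
      by (intro conjI exI[of _ p] comonoid 1 2 3) (use hom in simp)
  qed
qed

end

theorem theorem4p7:
  fixes C :: "('o, 'm, 'z) brcat_scheme" (structure)
    and X :: "'x set"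
    and a :: "'x \<Rightarrow> 'x \<Rightarrow> 'o"
    and \<delta> \<epsilon> :: "'x \<Rightarrow> 'x \<Rightarrow> 'm"
    and \<mu> :: "'x \<Rightarrow> 'x \<Rightarrow> 'x \<Rightarrow> 'm"
    and \<eta> :: "'x \<Rightarrow> 'm"
  assumes hopf: "hopf_category C X a \<delta> \<epsilon> \<mu> \<eta>"
  defines "i \<equiv> coseparable
      (span_category C X :: (('x, 's, 'o) span, ('x, 's, 'o, 'm) span_arrow) moncat)
      (square_span X a) (span_comult C X a \<delta>) (span_counit C X a \<epsilon>)"
    and "i' \<equiv> \<forall>x\<in>X. \<forall>y\<in>X. coseparable C (a x y) (\<delta> x y) (\<epsilon> x y)"
    and "ii \<equiv> \<forall>x\<in>X. \<exists>\<theta>\<in>hom C (a x x) \<K>.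
      \<rho> (a x x) \<cdot> (\<one> (a x x) \<otimes> \<theta>) \<cdot> \<delta> x x = \<eta> x \<cdot> \<theta> \<and> \<theta> \<cdot> \<eta> x = \<one> \<K>"
    and "iii \<equiv> \<forall>x\<in>X. \<exists>\<theta>\<in>hom C (a x x) \<K>.
      \<lambda>\<lambda> (a x x) \<cdot> (\<theta> \<otimes> \<one> (a x x)) \<cdot> \<delta> x x = \<eta> x \<cdot> \<theta> \<and> \<theta> \<cdot> \<eta> x = \<one> \<K>"
  shows "(i \<longleftrightarrow> i') \<and> (i' \<longleftrightarrow> ii) \<and> (ii \<longleftrightarrow> iii)"
proof -
  interpret hopf_category C X a \<delta> \<epsilon> \<mu> \<eta>
    by (rule hopf)
  show ?thesis
    unfolding i_def i'_def ii_def iii_def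
    using span_coseparable_iff[of X a \<delta> \<epsilon>, OF hom_comonoid] coseparable_iff_left_retraction
      coseparable_iff_right_retraction
    by blast
qed

end
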